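(* Let $(M,g,\mathbb Q)$ be a quaternionic contact (qc) manifold of dimension $4n+3$, $n\ge1$. The qc structure is an $Sp(n)Sp(1)$-hypo structure, i.e. $d\Omega_{\mathbb Q}=0$ where $$\Omega_{\mathbb Q}=\omega_1^2+\omega_2^2+\omega_3^2+2\omega_1\wedge\eta_2\wedge\eta_3+2\omega_2\wedge\eta_3\wedge\eta_1+2\omega_3\wedge\eta_1\wedge\eta_2,$$ if and only if its fundamental four form $\Omega=\omega_1\wedge\omega_1+\omega_2\wedge\omega_2+\omega_3\wedge\omega_3$ is closed, $d\Omega=0$.
   Context: Quaternionic contact (qc) structure on a $(4n+3)$-manifold $M$: a codimension three distribution $H$, locally the kernel of an $\mathbb R^3$-valued $1$-form $\eta=(\eta_1,\eta_2,\eta_3)$, with a Riemannian metric $g$ on $H$ and a rank-three bundle $\mathbb Q$ of endomorphisms of $H$ locally generated by almost complex structures $I_1,I_2,I_3$ on $H$ with $I_1I_2=-I_2I_1=I_3$, $I_1I_2I_3=-\mathrm{id}_H$, $g(I_s\cdot,I_s\cdot)=g(\cdot,\cdot)$ and $2g(I_sX,Y)=d\eta_s(X,Y)$ for $X,Y\in H$. The Reeb vector fields $\xi_1,\xi_2,\xi_3$ are determined by $\eta_s(\xi_k)=\delta_{sk}$, $(\xi_s\lrcorner d\eta_s)|_H=0$, $(\xi_s\lrcorner d\eta_k)|_H=-(\xi_k\lrcorner d\eta_s)|_H$; they exist automatically if $n>1$, and for $n=1$ their existence is part of the definition of a qc structure. $V=\mathrm{span}\{\xi_1,\xi_2,\xi_3\}$.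 The $2$-forms $\omega_s$ on $M$ are defined by $2\omega_s|_H=d\eta_s|_H$ and $\xi\lrcorner\omega_s=0$ for $\xi\in V$. The 4-forms $\Omega$ and $\Omega_{\mathbb Q}$ are $Sp(n)Sp(1)$-invariant, hence globally defined. $\omega^2$ means $\omega\wedge\omega$. *)

theory Defs
  imports "HOL-Analysis.Analysis"
begin

section \<open>Smooth manifolds\<close>

text \<open>\<open>Ck_on k S f\<close>: on the open set \<open>S\<close> the map \<open>f\<close> has continuous iterated directional
  derivatives up to order \<open>k\<close>.\<close>

fun Ck_on :: "nat \<Rightarrow> 'e::euclidean_space set \<Rightarrow> ('e \<Rightarrow> 'f::real_normed_vector) \<Rightarrow> bool" where
  "Ck_on 0 S f \<longleftrightarrow> continuous_on S f"
| "Ck_on (Suc k) S f \<longleftrightarrow>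
     (\<forall>x\<in>S. f differentiable (at x)) \<and> (\<forall>v. Ck_on k S (\<lambda>x. frechet_derivative f (at x) v))"

definition smooth_on :: "'e::euclidean_space set \<Rightarrow> ('e \<Rightarrow> 'f::real_normed_vector) \<Rightarrow> bool" where
  "smooth_on S f \<longleftrightarrow> (\<forall>k. Ck_on k S f)"

type_synonym ('a, 'e) chart = "'a set \<times> ('a \<Rightarrow> 'e)"

abbreviation chart_inv :: "('a, 'e) chart \<Rightarrow> 'e \<Rightarrow> 'a" where
  "chart_inv c \<equiv> inv_into (fst c) (snd c)"

definition transition :: "('a, 'e) chart \<Rightarrow> ('a, 'e) chart \<Rightarrow> 'e \<Rightarrow> 'e" where
  "transition c d = snd d \<circ> chart_inv c"

definition smooth_atlas ::
  "'a::topological_space set \<Rightarrow> ('a, 'e::euclidean_space) chart set \<Rightarrow> bool" where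
  "smooth_atlas M A \<longleftrightarrow>
     M = (\<Union>c\<in>A. fst c) \<and>
     (\<forall>c\<in>A. open (fst c) \<and> open (snd c ` fst c) \<and>
        homeomorphism (fst c) (snd c ` fst c) (snd c) (chart_inv c)) \<and>
     (\<forall>c\<in>A. \<forall>d\<in>A. smooth_on (snd c ` (fst c \<inter> fst d)) (transition c d))"

text \<open>Every point \<open>p\<close> gets a reference chart, and a tangent vector at \<open>p\<close> is represented by its
  coordinate vector in that chart, so each tangent space is a copy of \<^typ>\<open>'e\<close>.
  \<open>change_coord c d p\<close> converts the coordinates of a tangent vector at \<open>p\<close> from chart \<open>c\<close> to
  chart \<open>d\<close>.  The reference chart may jump from point to point; smoothness of fields is
  therefore always expressed through their components in a fixed chart.\<close>

definition chart_at :: "('a, 'e) chart set \<Rightarrow> 'a \<Rightarrow> ('a, 'e) chart" where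
  "chart_at A p = (SOME c. c \<in> A \<and> p \<in> fst c)"

definition change_coord ::
  "('a, 'e::euclidean_space) chart \<Rightarrow> ('a, 'e) chart \<Rightarrow> 'a \<Rightarrow> 'e \<Rightarrow> 'e" where
  "change_coord c d p = frechet_derivative (transition c d) (at (snd c p))"

definition smooth_function ::
  "('a, 'e::euclidean_space) chart set \<Rightarrow> 'a set \<Rightarrow> ('a \<Rightarrow> real) \<Rightarrow> bool" where
  "smooth_function A U f \<longleftrightarrow> (\<forall>c\<in>A. smooth_on (snd c ` (U \<inter> fst c)) (\<lambda>x. f (chart_inv c x)))"

definition smooth_vector_field ::
  "('a, 'e::euclidean_space) chart set \<Rightarrow> 'a set \<Rightarrow> ('a \<Rightarrow> 'e) \<Rightarrow> bool" where
  "smooth_vector_field A U X \<longleftrightarrow>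
     (\<forall>c\<in>A. smooth_on (snd c ` (U \<inter> fst c))
        (\<lambda>x. let q = chart_inv c x in change_coord (chart_at A q) c q (X q)))"


section \<open>Differential forms\<close>

text \<open>A \<open>k\<close>-form assigns to a point a function of lists of tangent vectors; only its values on
  lists of length \<open>k\<close> are relevant.\<close>

type_synonym ('a, 'e) form = "'a \<Rightarrow> 'e list \<Rightarrow> real"

definition chart_rep ::
  "('a, 'e::euclidean_space) chart set \<Rightarrow> ('a, 'e) chart \<Rightarrow> ('a, 'e) form \<Rightarrow> 'e \<Rightarrow> 'e list \<Rightarrow> real"
where
  "chart_rep A c \<alpha> x vs =
     (let q = chart_inv c x in \<alpha> q (map (change_coord c (chart_at A q) q) vs))"

definition alternating_multilinear :: "nat \<Rightarrow> ('e::real_vector list \<Rightarrow> real) \<Rightarrow> bool" where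
  "alternating_multilinear k f \<longleftrightarrow>
     (\<forall>vs. length vs = k \<longrightarrow>
        (\<forall>i<k. linear (\<lambda>x. f (vs[i := x]))) \<and>
        (\<forall>i<k. \<forall>j<k. i \<noteq> j \<and> vs ! i = vs ! j \<longrightarrow> f vs = 0))"

definition smooth_form ::
  "('a, 'e::euclidean_space) chart set \<Rightarrow> 'a set \<Rightarrow> nat \<Rightarrow> ('a, 'e) form \<Rightarrow> bool" where
  "smooth_form A U k \<alpha> \<longleftrightarrow>
     (\<forall>p\<in>U. alternating_multilinear k (\<alpha> p)) \<and>
     (\<forall>c\<in>A. \<forall>vs. length vs = k \<longrightarrow>
        smooth_on (snd c ` (U \<inter> fst c)) (\<lambda>x. chart_rep A c \<alpha> x vs))"

text \<open>Normalised so that \<open>\<alpha> \<and> \<beta> = \<alpha> \<otimes> \<beta> - \<beta> \<otimes> \<alpha>\<close> for 1-forms; here \<open>\<alpha>\<close> has degree \<open>k\<close> and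
  \<open>\<beta>\<close> has degree \<open>l\<close>.\<close>

definition wedge :: "nat \<Rightarrow> nat \<Rightarrow> ('a, 'e) form \<Rightarrow> ('a, 'e) form \<Rightarrow> ('a, 'e) form" where
  "wedge k l \<alpha> \<beta> p vs =
     (\<Sum>\<sigma> | \<sigma> permutes {..<k + l}.
        of_int (sign \<sigma>) * \<alpha> p (map (\<lambda>i. vs ! \<sigma> i) [0..<k])
          * \<beta> p (map (\<lambda>i. vs ! \<sigma> i) [k..<k + l])) / (fact k * fact l)"

text \<open>The exterior derivative is computed at \<open>p\<close> in the reference chart of \<open>p\<close>, in which tangent
  vectors at \<open>p\<close> are their own coordinate vectors.  It is normalised so that
  \<open>d\<alpha>(X,Y) = X(\<alpha>(Y)) - Y(\<alpha>(X)) - \<alpha>([X,Y])\<close> for 1-forms.\<close>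

definition ext_d :: "('a, 'e::euclidean_space) chart set \<Rightarrow> ('a, 'e) form \<Rightarrow> ('a, 'e) form" where
  "ext_d A \<alpha> p vs =
     (let c = chart_at A p in
      \<Sum>i<length vs. (-1) ^ i *
        frechet_derivative (\<lambda>x. chart_rep A c \<alpha> x (take i vs @ drop (Suc i) vs))
          (at (snd c p)) (vs ! i))"

definition closed_form ::
  "('a, 'e::euclidean_space) chart set \<Rightarrow> 'a set \<Rightarrow> nat \<Rightarrow> ('a, 'e) form \<Rightarrow> bool" where
  "closed_form A M k \<alpha> \<longleftrightarrow> (\<forall>p\<in>M. \<forall>vs. length vs = Suc k \<longrightarrow> ext_d A \<alpha> p vs = 0)"


section \<open>Quaternionic contact structures\<close>

definition smooth_section ::
  "('a, 'e::euclidean_space) chart set \<Rightarrow> ('a \<Rightarrow> 'e set) \<Rightarrow> 'a set \<Rightarrow> ('a \<Rightarrow> 'e) \<Rightarrow> bool" where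
  "smooth_section A H U X \<longleftrightarrow> smooth_vector_field A U X \<and> (\<forall>p\<in>U. X p \<in> H p)"

text \<open>Objects that live on \<open>H\<close> only (the metric, endomorphisms) are given by functions on the whole
  tangent space whose values off \<open>H\<close> are irrelevant.\<close>

definition endomorphism_on :: "'e::real_vector set \<Rightarrow> ('e \<Rightarrow> 'e) \<Rightarrow> bool" where
  "endomorphism_on S T \<longleftrightarrow>
     (\<forall>X\<in>S. T X \<in> S) \<and>
     (\<forall>X\<in>S. \<forall>Y\<in>S. \<forall>a b. T (a *\<^sub>R X + b *\<^sub>R Y) = a *\<^sub>R T X + b *\<^sub>R T Y)"

definition smooth_endomorphism ::
  "('a::topological_space, 'e::euclidean_space) chart set \<Rightarrow> ('a \<Rightarrow> 'e set) \<Rightarrow> 'a set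
     \<Rightarrow> ('a \<Rightarrow> 'e \<Rightarrow> 'e) \<Rightarrow> bool" where
  "smooth_endomorphism A H U T \<longleftrightarrow>
     (\<forall>p\<in>U. endomorphism_on (H p) (T p)) \<and>
     (\<forall>W X. open W \<and> W \<subseteq> U \<and> smooth_section A H W X \<longrightarrow>
        smooth_section A H W (\<lambda>p. T p (X p)))"

definition inner_product_on :: "'e::real_vector set \<Rightarrow> ('e \<Rightarrow> 'e \<Rightarrow> real) \<Rightarrow> bool" where
  "inner_product_on S g \<longleftrightarrow>
     (\<forall>X\<in>S. \<forall>Y\<in>S. g X Y = g Y X) \<and>
     (\<forall>X\<in>S. \<forall>Y\<in>S. \<forall>Z\<in>S. \<forall>a b. g (a *\<^sub>R X + b *\<^sub>R Y) Z = a * g X Z + b * g Y Z) \<and>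
     (\<forall>X\<in>S. X \<noteq> 0 \<longrightarrow> g X X > 0)"

definition smooth_metric ::
  "('a::topological_space, 'e::euclidean_space) chart set \<Rightarrow> ('a \<Rightarrow> 'e set) \<Rightarrow> 'a set
     \<Rightarrow> ('a \<Rightarrow> 'e \<Rightarrow> 'e \<Rightarrow> real) \<Rightarrow> bool" where
  "smooth_metric A H U g \<longleftrightarrow>
     (\<forall>p\<in>U. inner_product_on (H p) (g p)) \<and>
     (\<forall>W X Y. open W \<and> W \<subseteq> U \<and> smooth_section A H W X \<and> smooth_section A H W Y \<longrightarrow>
        smooth_function A W (\<lambda>p. g p (X p) (Y p)))"

definition reeb_fields ::
  "('a, 'e::euclidean_space) chart set \<Rightarrow> ('a \<Rightarrow> 'e set) \<Rightarrow> 'a set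
     \<Rightarrow> (nat \<Rightarrow> ('a, 'e) form) \<Rightarrow> (nat \<Rightarrow> 'a \<Rightarrow> 'e) \<Rightarrow> bool" where
  "reeb_fields A H U \<eta> \<xi> \<longleftrightarrow>
     (\<forall>s\<in>{1,2,3}. smooth_vector_field A U (\<xi> s)) \<and>
     (\<forall>p\<in>U. \<forall>s\<in>{1,2,3}. \<forall>k\<in>{1,2,3}.
        \<eta> s p [\<xi> k p] = (if s = k then 1 else 0) \<and>
        (\<forall>X\<in>H p. ext_d A (\<eta> s) p [\<xi> s p, X] = 0) \<and>
        (\<forall>X\<in>H p. ext_d A (\<eta> k) p [\<xi> s p, X] = - ext_d A (\<eta> s) p [\<xi> k p, X]))"

text \<open>A local qc frame \<open>\<eta>\<^sub>s, I\<^sub>s, \<xi>\<^sub>s\<close> (with \<open>s = 1, 2, 3\<close>) of the structure \<open>(H, g, Q)\<close>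
  over \<open>U\<close>.\<close>

definition qc_frame ::
  "('a::topological_space, 'e::euclidean_space) chart set \<Rightarrow> ('a \<Rightarrow> 'e set)
     \<Rightarrow> ('a \<Rightarrow> 'e \<Rightarrow> 'e \<Rightarrow> real) \<Rightarrow> ('a \<Rightarrow> ('e \<Rightarrow> 'e) set) \<Rightarrow> 'a set
     \<Rightarrow> (nat \<Rightarrow> ('a, 'e) form) \<Rightarrow> (nat \<Rightarrow> 'a \<Rightarrow> 'e \<Rightarrow> 'e) \<Rightarrow> (nat \<Rightarrow> 'a \<Rightarrow> 'e) \<Rightarrow> bool" where
  "qc_frame A H g Q U \<eta> I \<xi> \<longleftrightarrow>
     open U \<and> U \<subseteq> (\<Union>c\<in>A. fst c) \<and>
     (\<forall>s\<in>{1,2,3}. smooth_form A U 1 (\<eta> s) \<and> smooth_endomorphism A H U (I s)) \<and>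
     (\<forall>p\<in>U. H p = {X. \<forall>s\<in>{1,2,3}. \<eta> s p [X] = 0}) \<and>
     (\<forall>p\<in>U. Q p = {T. \<exists>a b c. \<forall>X\<in>H p. T X = a *\<^sub>R I 1 p X + b *\<^sub>R I 2 p X + c *\<^sub>R I 3 p X}) \<and>
     (\<forall>p\<in>U. \<forall>X\<in>H p.
        (\<forall>s\<in>{1,2,3}. I s p (I s p X) = - X) \<and>
        I 1 p (I 2 p X) = I 3 p X \<and>
        I 2 p (I 1 p X) = - I 3 p X \<and>
        I 1 p (I 2 p (I 3 p X)) = - X) \<and>
     (\<forall>p\<in>U. \<forall>s\<in>{1,2,3}. \<forall>X\<in>H p. \<forall>Y\<in>H p.
        g p (I s p X) (I s p Y) = g p X Y \<and>
        2 * g p (I s p X) Y = ext_d A (\<eta> s) p [X, Y]) \<and>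
     reeb_fields A H U \<eta> \<xi>"

text \<open>For \<open>n > 1\<close> the Reeb fields required in \<^const>\<open>qc_frame\<close> exist automatically by a theorem of
  Biquard; for \<open>n = 1\<close> their existence is part of the notion of a qc structure.\<close>

definition qc_manifold ::
  "nat \<Rightarrow> 'a::{t2_space,second_countable_topology} set \<Rightarrow> ('a, 'e::euclidean_space) chart set
     \<Rightarrow> ('a \<Rightarrow> 'e set) \<Rightarrow> ('a \<Rightarrow> 'e \<Rightarrow> 'e \<Rightarrow> real) \<Rightarrow> ('a \<Rightarrow> ('e \<Rightarrow> 'e) set) \<Rightarrow> bool" where
  "qc_manifold n M A H g Q \<longleftrightarrow>
     DIM('e) = 4 * n + 3 \<and> smooth_atlas M A \<and>
     (\<forall>p\<in>M. subspace (H p) \<and> dim (H p) = 4 * n) \<and>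
     smooth_metric A H M g \<and>
     (\<forall>p\<in>M. \<exists>U \<eta> I \<xi>. p \<in> U \<and> qc_frame A H g Q U \<eta> I \<xi>)"

text \<open>The projection of the tangent space onto \<open>H\<close> along \<open>V = span {\<xi>\<^sub>1, \<xi>\<^sub>2, \<xi>\<^sub>3}\<close>.\<close>

definition horizontal ::
  "(nat \<Rightarrow> ('a, 'e::real_vector) form) \<Rightarrow> (nat \<Rightarrow> 'a \<Rightarrow> 'e) \<Rightarrow> 'a \<Rightarrow> 'e \<Rightarrow> 'e" where
  "horizontal \<eta> \<xi> p X = X - (\<Sum>k\<in>{1,2,3}. \<eta> k p [X] *\<^sub>R \<xi> k p)"

text \<open>The unique 2-form \<open>\<omega>\<^sub>s\<close> with \<open>2 \<omega>\<^sub>s = d\<eta>\<^sub>s\<close> on \<open>H\<close> and \<open>\<omega>\<^sub>s(\<xi>, \<cdot>) = 0\<close> for \<open>\<xi> \<in> V\<close>.\<close>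

definition qc_omega ::
  "('a, 'e::euclidean_space) chart set \<Rightarrow> (nat \<Rightarrow> ('a, 'e) form) \<Rightarrow> (nat \<Rightarrow> 'a \<Rightarrow> 'e)
     \<Rightarrow> nat \<Rightarrow> ('a, 'e) form" where
  "qc_omega A \<eta> \<xi> s p vs = ext_d A (\<eta> s) p (map (horizontal \<eta> \<xi> p) vs) / 2"

definition local_Omega ::
  "('a, 'e::euclidean_space) chart set \<Rightarrow> (nat \<Rightarrow> ('a, 'e) form) \<Rightarrow> (nat \<Rightarrow> 'a \<Rightarrow> 'e)
     \<Rightarrow> ('a, 'e) form" where
  "local_Omega A \<eta> \<xi> p vs =
     (let \<omega> = qc_omega A \<eta> \<xi> in
       wedge 2 2 (\<omega> 1) (\<omega> 1) p vs + wedge 2 2 (\<omega> 2) (\<omega> 2) p vs + wedge 2 2 (\<omega> 3) (\<omega> 3) p vs)"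

definition local_Omega_Q ::
  "('a, 'e::euclidean_space) chart set \<Rightarrow> (nat \<Rightarrow> ('a, 'e) form) \<Rightarrow> (nat \<Rightarrow> 'a \<Rightarrow> 'e)
     \<Rightarrow> ('a, 'e) form" where
  "local_Omega_Q A \<eta> \<xi> p vs =
     (let \<omega> = qc_omega A \<eta> \<xi> in
       wedge 2 2 (\<omega> 1) (\<omega> 1) p vs + wedge 2 2 (\<omega> 2) (\<omega> 2) p vs + wedge 2 2 (\<omega> 3) (\<omega> 3) p vs
       + 2 * wedge 2 2 (\<omega> 1) (wedge 1 1 (\<eta> 2) (\<eta> 3)) p vs
       + 2 * wedge 2 2 (\<omega> 2) (wedge 1 1 (\<eta> 3) (\<eta> 1)) p vs
       + 2 * wedge 2 2 (\<omega> 3) (wedge 1 1 (\<eta> 1) (\<eta> 2)) p vs)"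

text \<open>Both local expressions are independent of the local qc frame, so the global 4-forms may be
  evaluated at \<open>p\<close> in any frame around \<open>p\<close>.\<close>

definition chosen_frame ::
  "('a::topological_space, 'e::euclidean_space) chart set \<Rightarrow> ('a \<Rightarrow> 'e set)
     \<Rightarrow> ('a \<Rightarrow> 'e \<Rightarrow> 'e \<Rightarrow> real) \<Rightarrow> ('a \<Rightarrow> ('e \<Rightarrow> 'e) set) \<Rightarrow> 'a
     \<Rightarrow> (nat \<Rightarrow> ('a, 'e) form) \<times> (nat \<Rightarrow> 'a \<Rightarrow> 'e)" where
  "chosen_frame A H g Q p =
     (SOME (\<eta>, \<xi>). \<exists>U I. p \<in> U \<and> qc_frame A H g Q U \<eta> I \<xi>)"

definition fundamental_four_form ::
  "('a::topological_space, 'e::euclidean_space) chart set \<Rightarrow> ('a \<Rightarrow> 'e set)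
     \<Rightarrow> ('a \<Rightarrow> 'e \<Rightarrow> 'e \<Rightarrow> real) \<Rightarrow> ('a \<Rightarrow> ('e \<Rightarrow> 'e) set) \<Rightarrow> ('a, 'e) form" where
  "fundamental_four_form A H g Q p =
     (case chosen_frame A H g Q p of (\<eta>, \<xi>) \<Rightarrow> local_Omega A \<eta> \<xi> p)"

definition Omega_Q ::
  "('a::topological_space, 'e::euclidean_space) chart set \<Rightarrow> ('a \<Rightarrow> 'e set)
     \<Rightarrow> ('a \<Rightarrow> 'e \<Rightarrow> 'e \<Rightarrow> real) \<Rightarrow> ('a \<Rightarrow> ('e \<Rightarrow> 'e) set) \<Rightarrow> ('a, 'e) form" where
  "Omega_Q A H g Q p =
     (case chosen_frame A H g Q p of (\<eta>, \<xi>) \<Rightarrow> local_Omega_Q A \<eta> \<xi> p)"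

definition sp_hypo ::
  "'a::topological_space set \<Rightarrow> ('a, 'e::euclidean_space) chart set \<Rightarrow> ('a \<Rightarrow> 'e set)
     \<Rightarrow> ('a \<Rightarrow> 'e \<Rightarrow> 'e \<Rightarrow> real) \<Rightarrow> ('a \<Rightarrow> ('e \<Rightarrow> 'e) set) \<Rightarrow> bool" where
  "sp_hypo M A H g Q \<longleftrightarrow> closed_form A M 4 (Omega_Q A H g Q)"

end

theory Submission
  imports Defs
begin

text \<open>
  On \<open>U\<close> the difference of the two 4-forms is exact:
  \<open>\<Omega>\<^sub>Q - \<Omega> = 2 \<omega>\<^sub>1 \<and> \<eta>\<^sub>2 \<and> \<eta>\<^sub>3 + \<dots> = d(\<eta>\<^sub>1 \<and> \<eta>\<^sub>2 \<and> \<eta>\<^sub>3)\<close>.  Indeed the Reeb condition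
  \<open>(\<xi>\<^sub>1 \<lrcorner> d\<eta>\<^sub>1)|\<^sub>H = 0\<close> says that \<open>d\<eta>\<^sub>1 - 2 \<omega>\<^sub>1\<close> lies in the ideal generated by \<open>\<eta>\<^sub>2\<close> and \<open>\<eta>\<^sub>3\<close>,
  hence is killed by \<open>\<eta>\<^sub>2 \<and> \<eta>\<^sub>3\<close>, and cyclically.  So \<open>d\<Omega>\<^sub>Q = d\<Omega>\<close>.

  The global forms use an arbitrary frame at each point, so differentiating them needs their frame
  independence: \<open>a\<^sub>s\<^sub>t = \<eta>'\<^sub>s(\<xi>\<^sub>t)\<close> lies in \<open>SO(3)\<close> because \<open>I'\<^sub>s = \<Sum>\<^sub>t a\<^sub>s\<^sub>t I\<^sub>t\<close>, and differentiating
  \<open>\<Sum>\<^sub>t a\<^sub>s\<^sub>t\<^sup>2 = 1\<close> shows that \<open>\<Sum>\<^sub>t a\<^sub>s\<^sub>t \<xi>\<^sub>t\<close> satisfies the Reeb condition for \<open>\<eta>'\<close>, so both frames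
  have the same vertical space.  Differentiability of \<open>\<Omega>\<close> in a chart is not optional either, because
  \<^const>\<open>frechet_derivative\<close> is arbitrary at points of non-differentiability.
\<close>

section \<open>Calculus of smooth maps\<close>

lemma smooth_on_differentiable:
  assumes "smooth_on S f" and "x \<in> S"
  shows "f differentiable (at x)"
proof -
  have "Ck_on (Suc 0) S f" using assms(1) unfolding smooth_on_def by blast
  then show ?thesis using assms(2) by simp
qed

lemma smooth_on_derivative:
  assumes "smooth_on S f"
  shows "smooth_on S (\<lambda>x. frechet_derivative f (at x) v)"
  unfolding smooth_on_def
proof
  fix k
  have "Ck_on (Suc k) S f" using assms unfolding smooth_on_def by blast
  then show "Ck_on k S (\<lambda>x. frechet_derivative f (at x) v)" by simp
qed

lemma smooth_on_imp_continuous_on: "smooth_on S f \<Longrightarrow> continuous_on S f"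
  unfolding smooth_on_def by (metis Ck_on.simps(1))

lemma Ck_on_subset: "S' \<subseteq> S \<Longrightarrow> Ck_on k S f \<Longrightarrow> Ck_on k S' f"
  by (induction k arbitrary: f) (auto intro: continuous_on_subset)

lemma smooth_on_subset: "S' \<subseteq> S \<Longrightarrow> smooth_on S f \<Longrightarrow> smooth_on S' f"
  unfolding smooth_on_def using Ck_on_subset by blast

text \<open>Both sides are the same Hilbert choice, since the two \<open>has_derivative\<close>
  predicates agree. So the equality also covers points where the maps are not
  differentiable.\<close>

lemma frechet_derivative_cong_open:
  assumes "open S" and "x \<in> S" and "\<And>y. y \<in> S \<Longrightarrow> f y = g y"
  shows "frechet_derivative f (at x) = frechet_derivative g (at x)"
proof -
  have "(f has_derivative D) (at x) \<longleftrightarrow> (g has_derivative D) (at x)" for D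
    using assms by (metis has_derivative_transform_within_open)
  then show ?thesis unfolding frechet_derivative_def by simp
qed

lemma differentiable_cong_open:
  assumes "open S" and "x \<in> S" and "\<And>y. y \<in> S \<Longrightarrow> f y = g y" and "f differentiable (at x)"
  shows "g differentiable (at x)"
  using assms unfolding differentiable_def by (meson has_derivative_transform_within_open)

lemma Ck_on_cong:
  assumes "open S"
  shows "(\<And>x. x \<in> S \<Longrightarrow> f x = g x) \<Longrightarrow> Ck_on k S f \<Longrightarrow> Ck_on k S g"
proof (induction k arbitrary: f g)
  case 0
  then show ?case using continuous_on_cong[of S S f g] by simp
next
  case (Suc k)
  have "g differentiable (at x)" if x: "x \<in> S" for x
    using Suc.prems x assms unfolding Ck_on.simps differentiable_def
    by (meson has_derivative_transform_within_open)
  moreover have "Ck_on k S (\<lambda>x. frechet_derivative g (at x) v)" for v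
  proof (rule Suc.IH)
    show "Ck_on k S (\<lambda>x. frechet_derivative f (at x) v)" using Suc.prems by simp
    show "frechet_derivative f (at x) v = frechet_derivative g (at x) v" if "x \<in> S" for x
      using frechet_derivative_cong_open[OF assms that Suc.prems(1)] by simp
  qed
  ultimately show ?case by simp
qed

lemma Ck_on_SucD: "Ck_on (Suc k) S f \<Longrightarrow> Ck_on k S f"
proof (induction k arbitrary: f)
  case 0
  then show ?case
    by (simp add: differentiable_imp_continuous_on differentiable_at_imp_differentiable_on)
next
  case (Suc k)
  then show ?case by simp
qed

lemma frechet_derivative_add_at:
  assumes "f differentiable (at x)" and "g differentiable (at x)"
  shows "frechet_derivative (\<lambda>y. f y + g y) (at x) v
    = frechet_derivative f (at x) v + frechet_derivative g (at x) v"
proof -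
  have "((\<lambda>y. f y + g y) has_derivative
    (\<lambda>v. frechet_derivative f (at x) v + frechet_derivative g (at x) v)) (at x)"
    using assms by (intro derivative_intros) (simp_all add: frechet_derivative_works[symmetric])
  from frechet_derivative_at[OF this] show ?thesis by metis
qed

lemma frechet_derivative_diff_at:
  assumes "f differentiable (at x)" and "g differentiable (at x)"
  shows "frechet_derivative (\<lambda>y. f y - g y) (at x) v
    = frechet_derivative f (at x) v - frechet_derivative g (at x) v"
proof -
  have "((\<lambda>y. f y - g y) has_derivative
    (\<lambda>v. frechet_derivative f (at x) v - frechet_derivative g (at x) v)) (at x)"
    using assms by (intro derivative_intros) (simp_all add: frechet_derivative_works[symmetric])
  from frechet_derivative_at[OF this] show ?thesis by metis
qed

lemma frechet_derivative_mult_at: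
  fixes f g :: "'e::real_normed_vector \<Rightarrow> real"
  assumes "f differentiable (at x)" and "g differentiable (at x)"
  shows "frechet_derivative (\<lambda>y. f y * g y) (at x) v
    = frechet_derivative f (at x) v * g x + f x * frechet_derivative g (at x) v"
proof -
  have "((\<lambda>y. f y * g y) has_derivative
    (\<lambda>v. f x * frechet_derivative g (at x) v + frechet_derivative f (at x) v * g x)) (at x)"
    using assms by (intro derivative_intros) (simp_all add: frechet_derivative_works[symmetric])
  from frechet_derivative_at[OF this] show ?thesis by (metis add.commute)
qed

lemma frechet_derivative_sum_at:
  assumes "\<And>i. i \<in> I \<Longrightarrow> f i differentiable (at x)"
  shows "frechet_derivative (\<lambda>y. \<Sum>i\<in>I. f i y) (at x) v
    = (\<Sum>i\<in>I. frechet_derivative (f i) (at x) v)"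
proof -
  have "((\<lambda>y. \<Sum>i\<in>I. f i y) has_derivative
    (\<lambda>v. \<Sum>i\<in>I. frechet_derivative (f i) (at x) v)) (at x)"
    using assms by (intro derivative_intros) (simp_all add: frechet_derivative_works[symmetric])
  from frechet_derivative_at[OF this] show ?thesis by metis
qed

lemma frechet_derivative_inner_left_at:
  assumes "f differentiable (at x)"
  shows "frechet_derivative (\<lambda>y. f y \<bullet> b) (at x) v = frechet_derivative f (at x) v \<bullet> b"
proof -
  have "((\<lambda>y. f y \<bullet> b) has_derivative (\<lambda>v. frechet_derivative f (at x) v \<bullet> b)) (at x)"
    using assms by (intro derivative_intros) (simp_all add: frechet_derivative_works[symmetric])
  from frechet_derivative_at[OF this] show ?thesis by metis
qed

text \<open>The sum rule is available only at points of \<open>S\<close>. The induction hypothesis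
  is therefore applied to its right-hand side, and \<open>Ck_on_cong\<close>, which needs
  \<open>S\<close> open, carries the result to the actual derivative. Differences, products and
  components follow the same scheme.\<close>

lemma Ck_on_add:
  assumes "open S"
  shows "Ck_on k S f \<Longrightarrow> Ck_on k S g \<Longrightarrow> Ck_on k S (\<lambda>x. f x + g x)"
proof (induction k arbitrary: f g)
  case 0
  then show ?case by (simp add: continuous_on_add)
next
  case (Suc k)
  have "Ck_on k S (\<lambda>x. frechet_derivative (\<lambda>y. f y + g y) (at x) v)" for v
  proof (rule Ck_on_cong[OF assms])
    show "Ck_on k S (\<lambda>x. frechet_derivative f (at x) v + frechet_derivative g (at x) v)"
      using Suc by simp
  qed (use Suc.prems in \<open>simp add: frechet_derivative_add_at\<close>)
  then show ?case using Suc.prems by simp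
qed

lemma Ck_on_diff:
  assumes "open S"
  shows "Ck_on k S f \<Longrightarrow> Ck_on k S g \<Longrightarrow> Ck_on k S (\<lambda>x. f x - g x)"
proof (induction k arbitrary: f g)
  case 0
  then show ?case by (simp add: continuous_on_diff)
next
  case (Suc k)
  have "Ck_on k S (\<lambda>x. frechet_derivative (\<lambda>y. f y - g y) (at x) v)" for v
  proof (rule Ck_on_cong[OF assms])
    show "Ck_on k S (\<lambda>x. frechet_derivative f (at x) v - frechet_derivative g (at x) v)"
      using Suc by simp
  qed (use Suc.prems in \<open>simp add: frechet_derivative_diff_at\<close>)
  then show ?case using Suc.prems by simp
qed

lemma Ck_on_mult:
  fixes f g :: "'e::euclidean_space \<Rightarrow> real"
  assumes "open S"
  shows "Ck_on k S f \<Longrightarrow> Ck_on k S g \<Longrightarrow> Ck_on k S (\<lambda>x. f x * g x)"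
proof (induction k arbitrary: f g)
  case 0
  then show ?case by (simp add: continuous_on_mult)
next
  case (Suc k)
  have "Ck_on k S (\<lambda>x. frechet_derivative (\<lambda>y. f y * g y) (at x) v)" for v
  proof (rule Ck_on_cong[OF assms])
    \<comment> \<open>The product rule leaves an undifferentiated factor in each summand, so the
      induction hypothesis also asks for \<open>f\<close> and \<open>g\<close> themselves at order
      \<open>k\<close>.\<close>
    show "Ck_on k S (\<lambda>x. frechet_derivative f (at x) v * g x + f x * frechet_derivative g (at x) v)"
      using Suc.prems Ck_on_SucD[OF Suc.prems(1)] Ck_on_SucD[OF Suc.prems(2)]
      by (intro Ck_on_add[OF assms] Suc.IH) simp_all
  qed (use Suc.prems in \<open>simp add: frechet_derivative_mult_at\<close>)
  then show ?case using Suc.prems by simp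
qed

lemma Ck_on_inner_left:
  assumes "open S"
  shows "Ck_on k S f \<Longrightarrow> Ck_on k S (\<lambda>x. f x \<bullet> b)"
proof (induction k arbitrary: f)
  case 0
  then show ?case by (simp add: continuous_on_inner)
next
  case (Suc k)
  have "Ck_on k S (\<lambda>x. frechet_derivative (\<lambda>y. f y \<bullet> b) (at x) v)" for v
  proof (rule Ck_on_cong[OF assms])
    show "Ck_on k S (\<lambda>x. frechet_derivative f (at x) v \<bullet> b)"
      using Suc by simp
  qed (use Suc.prems in \<open>simp add: frechet_derivative_inner_left_at\<close>)
  then show ?case using Suc.prems by (simp add: differentiable_inner)
qed

lemma smooth_on_add: "open S \<Longrightarrow> smooth_on S f \<Longrightarrow> smooth_on S g \<Longrightarrow> smooth_on S (\<lambda>x. f x + g x)"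
  and smooth_on_diff: "open S \<Longrightarrow> smooth_on S f \<Longrightarrow> smooth_on S g \<Longrightarrow> smooth_on S (\<lambda>x. f x - g x)"
  by (simp_all add: smooth_on_def Ck_on_add Ck_on_diff)

lemma smooth_on_mult:
  fixes f g :: "'e::euclidean_space \<Rightarrow> real"
  shows "open S \<Longrightarrow> smooth_on S f \<Longrightarrow> smooth_on S g \<Longrightarrow> smooth_on S (\<lambda>x. f x * g x)"
  by (simp add: smooth_on_def Ck_on_mult)

lemma smooth_on_inner_left: "open S \<Longrightarrow> smooth_on S f \<Longrightarrow> smooth_on S (\<lambda>x. f x \<bullet> b)"
  by (simp add: smooth_on_def Ck_on_inner_left)

section \<open>Symmetry of second derivatives\<close>

text \<open>Two applications of the mean value theorem: first along \<open>u\<close> to the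
  increment of \<open>f\<close> in direction \<open>v\<close>, then along \<open>v\<close> to the
  directional derivative of \<open>f\<close> in direction \<open>u\<close>.\<close>

lemma double_difference_mean_value:
  fixes f :: "'e::euclidean_space \<Rightarrow> real"
  assumes "smooth_on S f" and "t > 0"
    and S: "\<And>a b. 0 \<le> a \<Longrightarrow> a \<le> t \<Longrightarrow> 0 \<le> b \<Longrightarrow> b \<le> t \<Longrightarrow> x + a *\<^sub>R u + b *\<^sub>R v \<in> S"
  obtains a b where "0 \<le> a" "a \<le> t" "0 \<le> b" "b \<le> t"
    "f (x + t *\<^sub>R u + t *\<^sub>R v) - f (x + t *\<^sub>R u) - f (x + t *\<^sub>R v) + f x
      = t * t * frechet_derivative (\<lambda>y. frechet_derivative f (at y) u) (at (x + a *\<^sub>R u + b *\<^sub>R v)) v"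
proof -
  \<comment> \<open>Stated for a general \<open>h\<close> because it serves both \<open>f\<close>
    and its directional derivative.\<close>
  have along: "((\<lambda>s. h (y + s *\<^sub>R w)) has_real_derivative
      frechet_derivative h (at (y + s *\<^sub>R w)) w) (at s)"
    if h: "h differentiable (at (y + s *\<^sub>R w))" for h :: "'e \<Rightarrow> real" and y w s
  proof -
    have "((\<lambda>s. h (y + s *\<^sub>R w)) has_derivative
        (\<lambda>r. frechet_derivative h (at (y + s *\<^sub>R w)) (r *\<^sub>R w))) (at s)"
      by (rule has_derivative_compose[where f = "\<lambda>s. y + s *\<^sub>R w"])
        (auto intro!: derivative_eq_intros simp: frechet_derivative_works[symmetric] h)
    moreover have "frechet_derivative h (at (y + s *\<^sub>R w)) (r *\<^sub>R w)
        = r * frechet_derivative h (at (y + s *\<^sub>R w)) w" for r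
      using linear_frechet_derivative[OF h] by (simp add: linear_cmul)
    ultimately show ?thesis by (simp add: has_field_derivative_def mult_commute_abs)
  qed
  define \<phi> where "\<phi> s = f ((x + t *\<^sub>R v) + s *\<^sub>R u) - f (x + s *\<^sub>R u)" for s
  have d: "f differentiable (at y)" if "y \<in> S" for y
    using assms(1) that by (rule smooth_on_differentiable)
  have "\<exists>a>0. a < t \<and> \<phi> t - \<phi> 0 = (t - 0) *
     (frechet_derivative f (at ((x + t *\<^sub>R v) + a *\<^sub>R u)) u - frechet_derivative f (at (x + a *\<^sub>R u)) u)"
  proof (rule MVT2[OF \<open>t > 0\<close>])
    fix a assume a: "0 \<le> a" "a \<le> t"
    have "x + t *\<^sub>R v + a *\<^sub>R u \<in> S" "x + a *\<^sub>R u \<in> S"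
      using S[of a t] S[of a 0] a \<open>t > 0\<close> by (simp_all add: algebra_simps)
    then show "(\<phi> has_real_derivative frechet_derivative f (at ((x + t *\<^sub>R v) + a *\<^sub>R u)) u
        - frechet_derivative f (at (x + a *\<^sub>R u)) u) (at a)"
      unfolding \<phi>_def by (intro DERIV_diff along d)
  qed
  then obtain a where a: "0 < a" "a < t" and \<phi>: "\<phi> t - \<phi> 0 = t *
     (frechet_derivative f (at ((x + t *\<^sub>R v) + a *\<^sub>R u)) u - frechet_derivative f (at (x + a *\<^sub>R u)) u)"
    by auto
  define \<psi> where "\<psi> s = frechet_derivative f (at ((x + a *\<^sub>R u) + s *\<^sub>R v)) u" for s
  have "\<exists>b>0. b < t \<and> \<psi> t - \<psi> 0 = (t - 0) *
     frechet_derivative (\<lambda>y. frechet_derivative f (at y) u) (at ((x + a *\<^sub>R u) + b *\<^sub>R v)) v"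
  proof (rule MVT2[OF \<open>t > 0\<close>])
    fix b assume b: "0 \<le> b" "b \<le> t"
    have "x + a *\<^sub>R u + b *\<^sub>R v \<in> S" using S[of a b] a b by simp
    then show "(\<psi> has_real_derivative frechet_derivative (\<lambda>y. frechet_derivative f (at y) u)
        (at ((x + a *\<^sub>R u) + b *\<^sub>R v)) v) (at b)"
      unfolding \<psi>_def
      by (intro along[where h = "\<lambda>y. frechet_derivative f (at y) u"]
          smooth_on_differentiable[OF smooth_on_derivative[OF assms(1)]])
  qed
  then obtain b where b: "0 < b" "b < t" and \<psi>: "\<psi> t - \<psi> 0 = t *
     frechet_derivative (\<lambda>y. frechet_derivative f (at y) u) (at ((x + a *\<^sub>R u) + b *\<^sub>R v)) v"
    by auto
  have "\<phi> t - \<phi> 0 = t * (\<psi> t - \<psi> 0)"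
    unfolding \<phi> \<psi>_def by (simp add: algebra_simps)
  moreover have "\<phi> t - \<phi> 0
      = f (x + t *\<^sub>R u + t *\<^sub>R v) - f (x + t *\<^sub>R u) - f (x + t *\<^sub>R v) + f x"
    unfolding \<phi>_def by (simp add: algebra_simps)
  ultimately show ?thesis using that[of a b] a b \<psi> by simp
qed

text \<open>The double difference is symmetric in \<open>u\<close> and \<open>v\<close>. Divided by
  the square of \<open>t\<close>, it is a value of each mixed derivative at some point of a small
  parallelogram. By continuity both values lie within half the supposed gap of the mixed derivatives
  at \<open>x\<close>, which is absurd.\<close>

lemma second_derivative_symmetric_real:
  fixes f :: "'e::euclidean_space \<Rightarrow> real"
  assumes "open S" and "x \<in> S" and "smooth_on S f"
  shows "frechet_derivative (\<lambda>y. frechet_derivative f (at y) u) (at x) v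
    = frechet_derivative (\<lambda>y. frechet_derivative f (at y) v) (at x) u"
proof (rule ccontr)
  define F where "F u v y = frechet_derivative (\<lambda>y. frechet_derivative f (at y) u) (at y) v" for u v y
  assume "\<not> ?thesis"
  then have pos: "\<bar>F u v x - F v u x\<bar> / 2 > 0" by (simp add: F_def)
  have cont: "isCont (F u v) x" for u v
    using smooth_on_imp_continuous_on[OF smooth_on_derivative[OF smooth_on_derivative[OF assms(3)]]]
      assms(1,2) unfolding F_def by (simp add: continuous_on_eq_continuous_at)
  obtain r where r: "r > 0" "\<And>y. dist y x < r \<Longrightarrow> y \<in> S"
    using assms(1,2) by (metis open_dist)
  obtain d1 where d1: "d1 > 0"
    "\<And>y. dist y x < d1 \<Longrightarrow> dist (F u v y) (F u v x) < \<bar>F u v x - F v u x\<bar> / 2"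
    using cont[of u v] pos unfolding continuous_at_eps_delta by metis
  obtain d2 where d2: "d2 > 0"
    "\<And>y. dist y x < d2 \<Longrightarrow> dist (F v u y) (F v u x) < \<bar>F u v x - F v u x\<bar> / 2"
    using cont[of v u] pos unfolding continuous_at_eps_delta by metis
  define m where "m = min r (min d1 d2)"
  \<comment> \<open>Small enough to keep the whole parallelogram closer to \<open>x\<close> than
    \<open>m\<close>; the summand 1 keeps the denominator positive for
    \<open>u = v = 0\<close>.\<close>
  define t where "t = m / (2 * (norm u + norm v + 1))"
  have "m > 0" using r(1) d1(1) d2(1) by (simp add: m_def)
  have den: "2 * (norm u + norm v + 1) > 0" by (smt (verit) norm_ge_zero)
  then have "t > 0" unfolding t_def using \<open>m > 0\<close> by (rule divide_pos_pos[rotated])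
  have close: "dist (x + a *\<^sub>R u + b *\<^sub>R v) x < m"
    if "0 \<le> a" "a \<le> t" "0 \<le> b" "b \<le> t" for a b
  proof -
    have "dist (x + a *\<^sub>R u + b *\<^sub>R v) x = norm (a *\<^sub>R u + b *\<^sub>R v)"
      by (simp add: dist_norm add.assoc)
    also have "\<dots> \<le> a * norm u + b * norm v"
      using norm_triangle_ineq[of "a *\<^sub>R u" "b *\<^sub>R v"] that by simp
    also have "\<dots> \<le> t * norm u + t * norm v"
      using that by (intro add_mono mult_right_mono) auto
    also have "\<dots> < t * (2 * (norm u + norm v + 1))"
    proof -
      have "t * (2 * (norm u + norm v + 1)) = t * norm u + t * norm v + t * (norm u + norm v + 2)"
        by (simp add: algebra_simps)
      moreover have "t * (norm u + norm v + 2) > 0"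
        using \<open>t > 0\<close> by (intro mult_pos_pos) (auto intro: add_nonneg_pos)
      ultimately show ?thesis by linarith
    qed
    also have "\<dots> = m" unfolding t_def using den by simp
    finally show ?thesis .
  qed
  obtain a b where ab: "0 \<le> a" "a \<le> t" "0 \<le> b" "b \<le> t"
    "f (x + t *\<^sub>R u + t *\<^sub>R v) - f (x + t *\<^sub>R u) - f (x + t *\<^sub>R v) + f x
      = t * t * F u v (x + a *\<^sub>R u + b *\<^sub>R v)"
    using double_difference_mean_value[OF assms(3) \<open>t > 0\<close>, of x u v thesis] close r(2)
    unfolding F_def m_def by auto
  obtain a' b' where ab': "0 \<le> a'" "a' \<le> t" "0 \<le> b'" "b' \<le> t"
    "f (x + t *\<^sub>R v + t *\<^sub>R u) - f (x + t *\<^sub>R v) - f (x + t *\<^sub>R u) + f x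
      = t * t * F v u (x + a' *\<^sub>R v + b' *\<^sub>R u)"
  proof (rule double_difference_mean_value[OF assms(3) \<open>t > 0\<close>, of x v u])
    fix a b assume "0 \<le> a" "a \<le> t" "0 \<le> b" "b \<le> t"
    then show "x + a *\<^sub>R v + b *\<^sub>R u \<in> S"
      using close[of b a] r(2) by (simp add: m_def algebra_simps)
  qed (use that in \<open>simp add: F_def\<close>)
  have "t * t * F u v (x + a *\<^sub>R u + b *\<^sub>R v) = t * t * F v u (x + a' *\<^sub>R v + b' *\<^sub>R u)"
    using ab(5) ab'(5) by (simp add: algebra_simps)
  then have eq: "F u v (x + a *\<^sub>R u + b *\<^sub>R v) = F v u (x + a' *\<^sub>R v + b' *\<^sub>R u)"
    using \<open>t > 0\<close> by simp
  have "dist (x + a' *\<^sub>R v + b' *\<^sub>R u) x < m"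
    using close[OF ab'(3,4,1,2)] by (simp add: algebra_simps)
  then have "\<bar>F v u (x + a' *\<^sub>R v + b' *\<^sub>R u) - F v u x\<bar> < \<bar>F u v x - F v u x\<bar> / 2"
    using d2(2) by (simp add: m_def dist_real_def)
  moreover have "\<bar>F u v (x + a *\<^sub>R u + b *\<^sub>R v) - F u v x\<bar> < \<bar>F u v x - F v u x\<bar> / 2"
    using d1(2) close[OF ab(1-4)] by (simp add: m_def dist_real_def)
  moreover have "\<bar>F u v x - F v u x\<bar> \<le> \<bar>F v u (x + a' *\<^sub>R v + b' *\<^sub>R u) - F v u x\<bar>
      + \<bar>F u v (x + a *\<^sub>R u + b *\<^sub>R v) - F u v x\<bar>"
    unfolding eq by arith
  ultimately show False by argo
qed

lemma second_derivative_symmetric: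
  fixes f :: "'e::euclidean_space \<Rightarrow> 'f::euclidean_space"
  assumes "open S" and "x \<in> S" and "smooth_on S f"
  shows "frechet_derivative (\<lambda>y. frechet_derivative f (at y) u) (at x) v
    = frechet_derivative (\<lambda>y. frechet_derivative f (at y) v) (at x) u"
proof (rule euclidean_eqI)
  fix b :: 'f
  have comp: "frechet_derivative (\<lambda>y. frechet_derivative (\<lambda>z. f z \<bullet> b) (at y) u) (at x) v
      = frechet_derivative (\<lambda>y. frechet_derivative f (at y) u) (at x) v \<bullet> b" for u v
  proof -
    have "frechet_derivative (\<lambda>y. frechet_derivative (\<lambda>z. f z \<bullet> b) (at y) u) (at x)
      = frechet_derivative (\<lambda>y. frechet_derivative f (at y) u \<bullet> b) (at x)"
      by (intro frechet_derivative_cong_open[OF assms(1,2)] frechet_derivative_inner_left_at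
          smooth_on_differentiable[OF assms(3)])
    then show ?thesis
      by (simp add: frechet_derivative_inner_left_at
          smooth_on_differentiable[OF smooth_on_derivative[OF assms(3)] assms(2)])
  qed
  show "frechet_derivative (\<lambda>y. frechet_derivative f (at y) u) (at x) v \<bullet> b
    = frechet_derivative (\<lambda>y. frechet_derivative f (at y) v) (at x) u \<bullet> b"
    unfolding comp[symmetric]
    by (rule second_derivative_symmetric_real[OF assms(1,2) smooth_on_inner_left[OF assms(1,3)]])
qed

section \<open>Coordinate changes and the exterior derivative of 1-forms\<close>

text \<open>The coordinate formula for the exterior derivative on constant vector fields, whose
  bracket vanishes; \<open>e y v\<close> is the value at \<open>v\<close> of the 1-form at
  \<open>y\<close>.\<close>

definition coord_d :: "('e::real_normed_vector \<Rightarrow> 'e \<Rightarrow> real) \<Rightarrow> 'e \<Rightarrow> 'e \<Rightarrow> 'e \<Rightarrow> real" where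
  "coord_d e x u v =
     frechet_derivative (\<lambda>y. e y v) (at x) u - frechet_derivative (\<lambda>y. e y u) (at x) v"

lemma alternating_multilinear_1_linear:
  assumes "alternating_multilinear 1 f"
  shows "linear (\<lambda>v. f [v])"
proof -
  have "linear (\<lambda>x. f ([0][0 := x]))"
    using assms unfolding alternating_multilinear_def by (metis One_nat_def length_Cons list.size(3) zero_less_one)
  then show ?thesis by simp
qed

lemma linear_real_sum_Basis:
  fixes f :: "'e::euclidean_space \<Rightarrow> real"
  assumes "linear f"
  shows "f v = (\<Sum>b\<in>Basis. (v \<bullet> b) * f b)"
proof -
  have "f v = f (\<Sum>b\<in>Basis. (v \<bullet> b) *\<^sub>R b)" by (simp add: euclidean_representation)
  also have "\<dots> = (\<Sum>b\<in>Basis. (v \<bullet> b) * f b)"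
    by (simp add: linear_sum[OF assms] linear_cmul[OF assms])
  finally show ?thesis .
qed

locale atlas_manifold =
  fixes M :: "'a::topological_space set" and A :: "('a, 'e::euclidean_space) chart set"
  assumes atlas: "smooth_atlas M A"
begin

lemma fst_chart_open: "c \<in> A \<Longrightarrow> open (fst c)"
  using atlas unfolding smooth_atlas_def by blast

lemma chart_inv_chart:
  assumes "c \<in> A" and "q \<in> fst c"
  shows "chart_inv c (snd c q) = q"
  using atlas assms unfolding smooth_atlas_def homeomorphism_def by blast

lemma open_chart_image:
  assumes "c \<in> A" and "open U"
  shows "open (snd c ` (U \<inter> fst c))"
proof -
  have hom: "homeomorphism (fst c) (snd c ` fst c) (snd c) (chart_inv c)"
    and "open (fst c)" "open (snd c ` fst c)"
    using atlas assms(1) unfolding smooth_atlas_def by blast+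
  have "openin (top_of_set (fst c)) (U \<inter> fst c)"
    using assms(2) by (metis Int_commute openin_open)
  then have "openin (top_of_set (snd c ` fst c)) (snd c ` (U \<inter> fst c))"
    using homeomorphism_imp_open_map[OF hom] by blast
  then show ?thesis using \<open>open (snd c ` fst c)\<close> openin_open_trans by blast
qed

lemma chart_at_mem:
  assumes "q \<in> M"
  shows "chart_at A q \<in> A" and "q \<in> fst (chart_at A q)"
proof -
  have "\<exists>c. c \<in> A \<and> q \<in> fst c" using assms atlas unfolding smooth_atlas_def by blast
  from someI_ex[OF this] show "chart_at A q \<in> A" "q \<in> fst (chart_at A q)"
    unfolding chart_at_def by auto
qed

lemma transition_chart:
  assumes "c \<in> A" and "q \<in> fst c"
  shows "transition c d (snd c q) = snd d q"
  unfolding transition_def by (simp add: chart_inv_chart[OF assms])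

lemma transition_smooth:
  assumes "c \<in> A" and "d \<in> A"
  shows "smooth_on (snd c ` (fst c \<inter> fst d)) (transition c d)"
  using atlas assms unfolding smooth_atlas_def by blast

lemma transition_differentiable:
  assumes "c \<in> A" and "d \<in> A" and "q \<in> fst c" and "q \<in> fst d"
  shows "transition c d differentiable (at (snd c q))"
  by (rule smooth_on_differentiable[OF transition_smooth[OF assms(1,2)]]) (use assms in blast)

lemma linear_change_coord:
  assumes "c \<in> A" and "d \<in> A" and "q \<in> fst c" and "q \<in> fst d"
  shows "linear (change_coord c d q)"
  unfolding change_coord_def by (rule linear_frechet_derivative[OF transition_differentiable[OF assms]])

text \<open>The cocycle rule is the chain rule for transition maps. They compose on the image of the
  triple overlap, which is open, and that is enough for derivatives.\<close>

lemma change_coord_trans: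
  assumes "c \<in> A" "d \<in> A" "e \<in> A" and "q \<in> fst c" "q \<in> fst d" "q \<in> fst e"
  shows "change_coord d e q (change_coord c d q v) = change_coord c e q v"
proof -
  have "frechet_derivative (transition c e) (at (snd c q))
    = frechet_derivative (transition d e \<circ> transition c d) (at (snd c q))"
  proof (rule frechet_derivative_cong_open)
    show "open (snd c ` ((fst d \<inter> fst e) \<inter> fst c))"
      using open_chart_image fst_chart_open assms by blast
    show "snd c q \<in> snd c ` ((fst d \<inter> fst e) \<inter> fst c)" using assms by blast
  qed (use assms in \<open>auto simp: transition_chart\<close>)
  also have "\<dots> = frechet_derivative (transition d e) (at (transition c d (snd c q)))
      \<circ> frechet_derivative (transition c d) (at (snd c q))"
    using assms by (intro frechet_derivative_compose)
      (simp_all add: transition_differentiable transition_chart)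
  finally show ?thesis
    unfolding change_coord_def using assms by (simp add: transition_chart)
qed

lemma change_coord_self:
  assumes "c \<in> A" and "q \<in> fst c"
  shows "change_coord c c q v = v"
proof -
  have "frechet_derivative (transition c c) (at (snd c q)) = frechet_derivative (\<lambda>x. x) (at (snd c q))"
  proof (rule frechet_derivative_cong_open)
    show "open (snd c ` (UNIV \<inter> fst c))" using open_chart_image[OF assms(1)] by blast
  qed (use assms in \<open>auto simp: transition_chart\<close>)
  then show ?thesis unfolding change_coord_def by simp
qed

lemma chart_rep_chart:
  assumes "c \<in> A" and "q \<in> fst c"
  shows "chart_rep A c \<alpha> (snd c q) vs = \<alpha> q (map (change_coord c (chart_at A q) q) vs)"
  unfolding chart_rep_def using chart_inv_chart[OF assms] by simp

lemma ext_d_pair: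
  "ext_d A \<alpha> p [u, v] =
     coord_d (\<lambda>y v. chart_rep A (chart_at A p) \<alpha> y [v]) (snd (chart_at A p) p) u v"
  unfolding ext_d_def coord_d_def Let_def by (simp add: lessThan_Suc numeral_2_eq_2)

lemma chart_rep_linear:
  assumes "smooth_form A U 1 \<alpha>" and "U \<subseteq> M" and "c \<in> A" and "x \<in> snd c ` (U \<inter> fst c)"
  shows "linear (\<lambda>v. chart_rep A c \<alpha> x [v])"
proof -
  obtain q where q: "q \<in> U" "q \<in> fst c" "x = snd c q" using assms(4) by blast
  have "linear (\<lambda>v. \<alpha> q [v])"
    using assms(1) q(1) alternating_multilinear_1_linear unfolding smooth_form_def by blast
  from linear_compose[OF linear_change_coord this, of c "chart_at A q"]
  show ?thesis
    using assms q chart_at_mem[of q] chart_rep_chart[OF assms(3) q(2)] by (auto simp: o_def)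
qed

lemma chart_rep_smooth:
  assumes "smooth_form A U 1 \<alpha>" and "c \<in> A"
  shows "smooth_on (snd c ` (U \<inter> fst c)) (\<lambda>x. chart_rep A c \<alpha> x [v])"
  using assms unfolding smooth_form_def by simp

lemma chart_rep_change:
  assumes "smooth_form A U 1 \<alpha>" and "U \<subseteq> M" and "c \<in> A" and "d \<in> A"
    and "q \<in> U" and "q \<in> fst c" and "q \<in> fst d"
  shows "chart_rep A c \<alpha> (snd c q) [v]
    = chart_rep A d \<alpha> (snd d q) [change_coord c d q v]"
  using assms chart_at_mem[of q] by (auto simp: chart_rep_chart change_coord_trans subset_iff)

text \<open>Naturality of d. Differentiating the pulled back form \<open>f (T y) (DT v)\<close>
  gives a term with the derivative of \<open>f\<close>, which yields the right-hand side, and a term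
  with the second derivative of the transition map \<open>T\<close>, which is symmetric in
  \<open>u\<close>, \<open>v\<close> and disappears under antisymmetrisation.\<close>

lemma coord_d_change:
  assumes \<alpha>: "smooth_form A U 1 \<alpha>" and U: "U \<subseteq> M" "open U" and c: "c \<in> A" and d: "d \<in> A"
    and p: "p \<in> U" "p \<in> fst c" "p \<in> fst d"
  shows "coord_d (\<lambda>y v. chart_rep A c \<alpha> y [v]) (snd c p) u v
    = coord_d (\<lambda>y v. chart_rep A d \<alpha> y [v]) (snd d p) (change_coord c d p u) (change_coord c d p v)"
proof -
  define T where "T = transition c d"
  define W where "W = snd c ` ((U \<inter> fst d) \<inter> fst c)"
  define e where "e y v = chart_rep A c \<alpha> y [v]" for y v
  define f where "f y v = chart_rep A d \<alpha> y [v]" for y v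
  have W: "open W" "snd c p \<in> W"
    using p unfolding W_def by (auto intro!: open_chart_image c open_Int U fst_chart_open d)
  have T: "smooth_on W T"
  proof -
    have "W \<subseteq> snd c ` (fst c \<inter> fst d)" unfolding W_def by blast
    then show ?thesis
      using transition_smooth[OF c d] unfolding T_def by (rule smooth_on_subset)
  qed
  have flin: "linear (f (snd d p))"
    unfolding f_def by (rule chart_rep_linear[OF \<alpha> U(1) d]) (use p in blast)
  have fdiff: "(\<lambda>y. f y v) differentiable (at (snd d p))" for v
    unfolding f_def by (rule smooth_on_differentiable[OF chart_rep_smooth[OF \<alpha> d]]) (use p in blast)
  have Tp: "T (snd c p) = snd d p" unfolding T_def using c p(2) by (rule transition_chart)
  have Tdiff: "T differentiable (at (snd c p))"
    using smooth_on_differentiable[OF T W(2)] .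
  have DTdiff: "(\<lambda>y. frechet_derivative T (at y) v) differentiable (at (snd c p))" for v
    using smooth_on_differentiable[OF smooth_on_derivative[OF T] W(2)] .
  have L: "change_coord c d p w = frechet_derivative T (at (snd c p)) w" for w
    unfolding change_coord_def T_def ..
  \<comment> \<open>Expanding over the basis separates the dependence on \<open>y\<close> through
    the base point from that through the vector, so that the product rule applies.\<close>
  have pull: "e y v = (\<Sum>b\<in>Basis. (frechet_derivative T (at y) v \<bullet> b) * f (T y) b)"
    if y: "y \<in> W" for y v
  proof -
    obtain q where q: "q \<in> U" "q \<in> fst d" "q \<in> fst c" "y = snd c q" using y unfolding W_def by blast
    have "linear (f (snd d q))"
      unfolding f_def by (rule chart_rep_linear[OF \<alpha> U(1) d]) (use q in blast)
    note lin = linear_real_sum_Basis[OF this]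
    have "e y v = f (T y) (frechet_derivative T (at y) v)"
      using chart_rep_change[OF \<alpha> U(1) c d q(1,3,2)] q transition_chart[OF c q(3)]
      unfolding e_def f_def T_def change_coord_def by simp
    also have "T y = snd d q" unfolding T_def using transition_chart[OF c q(3)] q(4) by simp
    finally show ?thesis using lin \<open>T y = snd d q\<close> by metis
  qed
  have fT: "(\<lambda>y. f (T y) b) differentiable (at (snd c p))"
    and DfT: "frechet_derivative (\<lambda>y. f (T y) b) (at (snd c p)) u
      = frechet_derivative (\<lambda>y. f y b) (at (snd d p)) (frechet_derivative T (at (snd c p)) u)" for b u
  proof -
    have f': "(\<lambda>y. f y b) differentiable (at (T (snd c p)))" using fdiff Tp by simp
    show "(\<lambda>y. f (T y) b) differentiable (at (snd c p))"
      using differentiable_chain_at[OF Tdiff f'] by (simp add: o_def)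
    show "frechet_derivative (\<lambda>y. f (T y) b) (at (snd c p)) u
      = frechet_derivative (\<lambda>y. f y b) (at (snd d p)) (frechet_derivative T (at (snd c p)) u)"
      using frechet_derivative_compose[OF Tdiff f'] Tp by (simp add: o_def)
  qed
  have De: "frechet_derivative (\<lambda>y. e y v) (at (snd c p)) u
      = f (snd d p) (frechet_derivative (\<lambda>y. frechet_derivative T (at y) v) (at (snd c p)) u)
        + frechet_derivative (\<lambda>y. f y (change_coord c d p v)) (at (snd d p)) (change_coord c d p u)"
    for u v
  proof -
    have "frechet_derivative (\<lambda>y. e y v) (at (snd c p))
      = frechet_derivative (\<lambda>y. \<Sum>b\<in>Basis. (frechet_derivative T (at y) v \<bullet> b) * f (T y) b) (at (snd c p))"
      by (rule frechet_derivative_cong_open[OF W pull])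
    then have 1: "frechet_derivative (\<lambda>y. e y v) (at (snd c p)) u
      = (\<Sum>b\<in>Basis. (frechet_derivative (\<lambda>y. frechet_derivative T (at y) v) (at (snd c p)) u \<bullet> b) * f (snd d p) b)
        + (\<Sum>b\<in>Basis. (change_coord c d p v \<bullet> b) *
             frechet_derivative (\<lambda>y. f y b) (at (snd d p)) (change_coord c d p u))"
      by (simp add: frechet_derivative_sum_at frechet_derivative_mult_at frechet_derivative_inner_left_at
          DTdiff fT DfT Tp L differentiable_inner sum.distrib)
    \<comment> \<open>Collapses the second sum of \<open>1\<close>, in which the vector is held
      fixed.\<close>
    have eq: "frechet_derivative (\<lambda>y. f y w) (at (snd d p)) u
        = (\<Sum>b\<in>Basis. (w \<bullet> b) * frechet_derivative (\<lambda>y. f y b) (at (snd d p)) u)" for w u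
    proof -
      have "frechet_derivative (\<lambda>y. f y w) (at (snd d p))
        = frechet_derivative (\<lambda>y. \<Sum>b\<in>Basis. (w \<bullet> b) * f y b) (at (snd d p))"
      proof (rule frechet_derivative_cong_open)
        show "open (snd d ` (U \<inter> fst d))" by (rule open_chart_image[OF d U(2)])
        show "snd d p \<in> snd d ` (U \<inter> fst d)" using p by blast
        show "f y w = (\<Sum>b\<in>Basis. (w \<bullet> b) * f y b)" if "y \<in> snd d ` (U \<inter> fst d)" for y
          unfolding f_def by (rule linear_real_sum_Basis[OF chart_rep_linear[OF \<alpha> U(1) d that]])
      qed
      then show ?thesis
        by (simp add: frechet_derivative_sum_at frechet_derivative_mult_at fdiff)
    qed
    show ?thesis
      using 1 linear_real_sum_Basis[OF flin,
          of "frechet_derivative (\<lambda>y. frechet_derivative T (at y) v) (at (snd c p)) u"]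
        eq[of "change_coord c d p v" "change_coord c d p u"] by linarith
  qed
  show ?thesis
    unfolding coord_d_def e_def[symmetric] f_def[symmetric] De
    using second_derivative_symmetric[OF W T, of u v] by simp
qed

text \<open>\<open>ext_d\<close> uses the reference chart of the point, which may jump. To
  differentiate a form built from an exterior derivative, its values at all nearby points have to be
  expressed in one fixed chart.\<close>

lemma ext_d_change_coord:
  assumes "smooth_form A U 1 \<alpha>" and "U \<subseteq> M" "open U" and "c \<in> A" and "p \<in> U" "p \<in> fst c"
  shows "ext_d A \<alpha> p [change_coord c (chart_at A p) p u, change_coord c (chart_at A p) p v]
    = coord_d (\<lambda>y v. chart_rep A c \<alpha> y [v]) (snd c p) u v"
  unfolding ext_d_pair using assms chart_at_mem[of p] coord_d_change[of U \<alpha> c "chart_at A p" p u v] by auto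

end

section \<open>Exterior algebra in low degrees\<close>

definition wedge11 :: "('e \<Rightarrow> real) \<Rightarrow> ('e \<Rightarrow> real) \<Rightarrow> 'e \<Rightarrow> 'e \<Rightarrow> real" where
  "wedge11 f g u v = f u * g v - f v * g u"

text \<open>The sum over the six (2,2)-shuffles, which is the wedge product of two antisymmetric
  bilinear forms.\<close>

definition wedge22 ::
  "('e \<Rightarrow> 'e \<Rightarrow> real) \<Rightarrow> ('e \<Rightarrow> 'e \<Rightarrow> real) \<Rightarrow> 'e \<Rightarrow> 'e \<Rightarrow> 'e \<Rightarrow> 'e \<Rightarrow> real" where
  "wedge22 F G a b c d = F a b * G c d - F a c * G b d + F a d * G b c
     + F b c * G a d - F b d * G a c + F c d * G a b"

lemma permutes_two_sum:
  fixes F :: "(nat \<Rightarrow> nat) \<Rightarrow> real"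
  shows "(\<Sum>\<sigma> | \<sigma> permutes {..<1 + 1}. F \<sigma>) = F id + F (Transposition.transpose 0 1)"
proof -
  have "{..<1 + 1} = insert 0 {1 :: nat}" by auto
  then show ?thesis
    by (simp add: sum_over_permutations_insert permutes_sing)
qed

lemma wedge_1_1: "wedge 1 1 \<alpha> \<beta> p [u, v] = wedge11 (\<lambda>x. \<alpha> p [x]) (\<lambda>x. \<beta> p [x]) u v"
  unfolding wedge_def permutes_two_sum wedge11_def by (simp add: sign_swap_id)

text \<open>The 24 permutations fall into six classes of four, one for each shuffle. Antisymmetry
  makes the summands of a class equal, and the denominator \<open>fact 2 * fact 2\<close> absorbs
  the multiplicity.\<close>

lemma wedge_2_2:
  assumes "\<And>u v. \<alpha> p [u, v] = - \<alpha> p [v, u]" and "\<And>u v. \<beta> p [u, v] = - \<beta> p [v, u]"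
  shows "wedge 2 2 \<alpha> \<beta> p [a, b, c, d]
    = wedge22 (\<lambda>x y. \<alpha> p [x, y]) (\<lambda>x y. \<beta> p [x, y]) a b c d"
proof -
  have set: "{..<2 + 2} = insert 0 (insert 1 (insert 2 {3 :: nat}))" by auto
  have upt: "[0..<2] = [0, 1 :: nat]" "[2..<2 + 2] = [2, 3 :: nat]"
    by (simp_all add: upt_rec)
  have fact2: "fact 2 = (2::real)" by (simp add: fact_numeral)
  \<comment> \<open>Side conditions for enumerating the permutations by splitting off 0, 1 and 2 in
    turn.\<close>
  have n: "finite {2, 3 :: nat}" "1 \<notin> {2, 3 :: nat}" "finite {3 :: nat}" "2 \<notin> {3 :: nat}"
    "finite {1, 2, 3 :: nat}" "0 \<notin> {1, 2, 3 :: nat}" by auto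
  \<comment> \<open>As rewrite rules these put the arguments of every factor into alphabetical
    order.\<close>
  note s = assms(1)[of b a] assms(1)[of c a] assms(1)[of d a] assms(1)[of c b]
    assms(1)[of d b] assms(1)[of d c] assms(2)[of b a] assms(2)[of c a] assms(2)[of d a]
    assms(2)[of c b] assms(2)[of d b] assms(2)[of d c]
  show ?thesis
    unfolding wedge_def set upt fact2
    unfolding sum_over_permutations_insert[OF n(5,6)] sum_over_permutations_insert[OF n(1,2)]
      sum_over_permutations_insert[OF n(3,4)] permutes_sing
    by (simp add: sign_swap_id permutation_swap_id permutation_compose sign_compose sign_id
        transpose_apply_other numeral_2_eq_2 numeral_3_eq_3 s wedge22_def field_simps)
qed

section \<open>Triple products of 1-forms and their exterior derivative\<close>

text \<open>The value of \<open>e \<and> f \<and> g\<close> on three vectors, as a 3 by 3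
  determinant.\<close>

definition volume3 :: "('e \<Rightarrow> real) \<Rightarrow> ('e \<Rightarrow> real) \<Rightarrow> ('e \<Rightarrow> real) \<Rightarrow> 'e \<Rightarrow> 'e \<Rightarrow> 'e \<Rightarrow> real" where
  "volume3 e f g a b c = e a * (f b * g c - f c * g b) - e b * (f a * g c - f c * g a)
     + e c * (f a * g b - f b * g a)"

definition coord_d3 ::
  "('e::real_normed_vector \<Rightarrow> 'e \<Rightarrow> 'e \<Rightarrow> 'e \<Rightarrow> real) \<Rightarrow> 'e \<Rightarrow> 'e \<Rightarrow> 'e \<Rightarrow> 'e \<Rightarrow> 'e \<Rightarrow> real" where
  "coord_d3 F x a b c d =
     frechet_derivative (\<lambda>y. F y b c d) (at x) a - frechet_derivative (\<lambda>y. F y a c d) (at x) b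
     + frechet_derivative (\<lambda>y. F y a b d) (at x) c - frechet_derivative (\<lambda>y. F y a b c) (at x) d"

text \<open>The Leibniz rule. Moving each differentiated factor to the front absorbs the signs and
  leaves the three terms in cyclic order, the order in which they occur in the difference of the two
  4-forms.\<close>

lemma coord_d3_volume3:
  assumes "\<And>v. (\<lambda>y. e y v) differentiable (at x)" "\<And>v. (\<lambda>y. f y v) differentiable (at x)"
    "\<And>v. (\<lambda>y. g y v) differentiable (at x)"
  shows "coord_d3 (\<lambda>y. volume3 (e y) (f y) (g y)) x a b c d
    = wedge22 (coord_d e x) (wedge11 (f x) (g x)) a b c d
      + wedge22 (coord_d f x) (wedge11 (g x) (e x)) a b c d
      + wedge22 (coord_d g x) (wedge11 (e x) (f x)) a b c d"
proof -
  have D: "frechet_derivative (\<lambda>y. volume3 (e y) (f y) (g y) a b c) (at x) v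
    = volume3 (\<lambda>w. frechet_derivative (\<lambda>y. e y w) (at x) v) (f x) (g x) a b c
      + volume3 (e x) (\<lambda>w. frechet_derivative (\<lambda>y. f y w) (at x) v) (g x) a b c
      + volume3 (e x) (f x) (\<lambda>w. frechet_derivative (\<lambda>y. g y w) (at x) v) a b c" for a b c v
    unfolding volume3_def
    by (simp add: frechet_derivative_add_at frechet_derivative_diff_at frechet_derivative_mult_at
        assms algebra_simps)
  show ?thesis
    unfolding coord_d3_def D unfolding volume3_def wedge22_def wedge11_def coord_d_def
    by (simp add: algebra_simps)
qed

lemma smooth_on_volume3:
  fixes e f g :: "'e::euclidean_space \<Rightarrow> 'e \<Rightarrow> real"
  assumes "open S" and "\<And>v. smooth_on S (\<lambda>y. e y v)" "\<And>v. smooth_on S (\<lambda>y. f y v)"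
    "\<And>v. smooth_on S (\<lambda>y. g y v)"
  shows "smooth_on S (\<lambda>y. volume3 (e y) (f y) (g y) a b c)"
  unfolding volume3_def
  by (intro smooth_on_add smooth_on_diff smooth_on_mult assms)

text \<open>d composed with itself vanishes on 3-forms: the twenty second derivatives cancel in ten
  pairs by symmetry.\<close>

lemma coord_d_coord_d3:
  fixes F :: "'e::euclidean_space \<Rightarrow> 'e \<Rightarrow> 'e \<Rightarrow> 'e \<Rightarrow> real"
  assumes S: "open S" "x \<in> S" and F: "\<And>a b c. smooth_on S (\<lambda>y. F y a b c)"
  shows "frechet_derivative (\<lambda>y. coord_d3 F y b c d e) (at x) a
    - frechet_derivative (\<lambda>y. coord_d3 F y a c d e) (at x) b
    + frechet_derivative (\<lambda>y. coord_d3 F y a b d e) (at x) c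
    - frechet_derivative (\<lambda>y. coord_d3 F y a b c e) (at x) d
    + frechet_derivative (\<lambda>y. coord_d3 F y a b c d) (at x) e = 0"
proof -
  define D where "D u v a b c
    = frechet_derivative (\<lambda>y. frechet_derivative (\<lambda>y. F y a b c) (at y) u) (at x) v" for u v a b c
  have diff: "(\<lambda>y. frechet_derivative (\<lambda>y. F y a b c) (at y) u) differentiable (at x)" for u a b c
    by (rule smooth_on_differentiable[OF smooth_on_derivative[OF F] S(2)])
  have sym: "D u v a b c = D v u a b c" for u v a b c
    unfolding D_def by (rule second_derivative_symmetric[OF S F])
  have "frechet_derivative (\<lambda>y. coord_d3 F y a b c d) (at x) v
    = D a v b c d - D b v a c d + D c v a b d - D d v a b c" for a b c d v
    unfolding coord_d3_def D_def
    by (simp add: frechet_derivative_add_at frechet_derivative_diff_at diff)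
  then show ?thesis
    using sym[of a b] sym[of a c] sym[of a d] sym[of a e] sym[of b c] sym[of b d] sym[of b e]
      sym[of c d] sym[of c e] sym[of d e] by simp
qed

text \<open>Summands in the ideal generated by \<open>p\<close> and \<open>q\<close> die against
  \<open>p \<and> q\<close>, because a factor is repeated.\<close>

lemma wedge22_cancel:
  assumes "\<And>u v. F u v = G u v + wedge11 p m u v + wedge11 q m' u v"
  shows "wedge22 F (wedge11 p q) a b c d = wedge22 G (wedge11 p q) a b c d"
  unfolding wedge22_def assms unfolding wedge11_def by (simp add: algebra_simps)

section \<open>Quaternionic contact frames\<close>

lemma linear_frechet_derivative_parameter:
  fixes e :: "'e::euclidean_space \<Rightarrow> 'e \<Rightarrow> real"
  assumes "open S" "x \<in> S" and "\<And>y. y \<in> S \<Longrightarrow> linear (e y)"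
    and "\<And>v. (\<lambda>y. e y v) differentiable (at x)"
  shows "linear (\<lambda>v. frechet_derivative (\<lambda>y. e y v) (at x) u)"
proof (rule linearI)
  fix v w :: 'e and r :: real
  have "frechet_derivative (\<lambda>y. e y (v + w)) (at x) = frechet_derivative (\<lambda>y. e y v + e y w) (at x)"
    using assms(3) by (intro frechet_derivative_cong_open[OF assms(1,2)]) (simp add: linear_add)
  then show "frechet_derivative (\<lambda>y. e y (v + w)) (at x) u
      = frechet_derivative (\<lambda>y. e y v) (at x) u + frechet_derivative (\<lambda>y. e y w) (at x) u"
    by (simp add: frechet_derivative_add_at assms(4))
  have "frechet_derivative (\<lambda>y. e y (r *\<^sub>R v)) (at x) = frechet_derivative (\<lambda>y. r * e y v) (at x)"
    using assms(3) by (intro frechet_derivative_cong_open[OF assms(1,2)]) (simp add: linear_cmul)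
  then show "frechet_derivative (\<lambda>y. e y (r *\<^sub>R v)) (at x) u
      = r *\<^sub>R frechet_derivative (\<lambda>y. e y v) (at x) u"
    by (simp add: frechet_derivative_mult_at assms(4))
qed

lemma coord_d_antisym: "coord_d e x u v = - coord_d e x v u"
  unfolding coord_d_def by simp

lemma bilinear_coord_d:
  fixes e :: "'e::euclidean_space \<Rightarrow> 'e \<Rightarrow> real"
  assumes "open S" "x \<in> S" and "\<And>y. y \<in> S \<Longrightarrow> linear (e y)"
    and "\<And>v. (\<lambda>y. e y v) differentiable (at x)"
  shows "bilinear (coord_d e x)"
  unfolding bilinear_def coord_d_def
  by (intro allI conjI linear_compose_sub linear_frechet_derivative assms(4)
      linear_frechet_derivative_parameter[OF assms])

text \<open>Differentiability for each fixed vector suffices, since linearity turns the value into a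
  finite sum of products of scalar functions.\<close>

lemma differentiable_eval:
  fixes F :: "'e::euclidean_space \<Rightarrow> 'e \<Rightarrow> real"
  assumes "open S" "x \<in> S" and "\<And>y. y \<in> S \<Longrightarrow> linear (F y)"
    and "\<And>v. (\<lambda>y. F y v) differentiable (at x)" and "X differentiable (at x)"
  shows "(\<lambda>y. F y (X y)) differentiable (at x)"
proof -
  have "(\<lambda>y. \<Sum>b\<in>Basis. (X y \<bullet> b) * F y b) differentiable (at x)"
    using assms(4,5) by (simp add: differentiable_inner)
  moreover have "(\<Sum>b\<in>Basis. (X y \<bullet> b) * F y b) = F y (X y)" if "y \<in> S" for y
    by (rule linear_real_sum_Basis[OF assms(3)[OF that], symmetric])
  ultimately show ?thesis by (rule differentiable_cong_open[OF assms(1,2), rotated])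
qed

section \<open>Metric, contact forms and almost complex structures of a frame\<close>

locale qc_geometry = atlas_manifold M A
  for M :: "'a::{t2_space,second_countable_topology} set"
    and A :: "('a, 'e::euclidean_space) chart set" +
  fixes n :: nat
    and H :: "'a \<Rightarrow> 'e set"
    and g :: "'a \<Rightarrow> 'e \<Rightarrow> 'e \<Rightarrow> real"
    and Q :: "'a \<Rightarrow> ('e \<Rightarrow> 'e) set"
  assumes n: "n \<ge> 1" and qc: "qc_manifold n M A H g Q"
begin

lemma H_subspace: "p \<in> M \<Longrightarrow> subspace (H p)"
  using qc unfolding qc_manifold_def by blast

text \<open>This is where \<open>n \<ge> 1\<close> enters. A nonzero horizontal \<open>X\<close> is
  what later allows coefficients of the vectors \<open>I s p X\<close> to be compared.\<close>

lemma H_nonzero: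
  assumes "p \<in> M"
  obtains X where "X \<in> H p" "X \<noteq> 0"
proof -
  have "dim (H p) = 4 * n" using qc assms unfolding qc_manifold_def by blast
  then have "\<not> H p \<subseteq> {0}" using n dim_eq_0[of "H p"] by simp
  then show ?thesis using that by blast
qed

lemma metric: "p \<in> M \<Longrightarrow> inner_product_on (H p) (g p)"
  using qc unfolding qc_manifold_def smooth_metric_def by blast

lemma g_sym: "p \<in> M \<Longrightarrow> X \<in> H p \<Longrightarrow> Y \<in> H p \<Longrightarrow> g p X Y = g p Y X"
  using metric unfolding inner_product_on_def by blast

lemma g_lin: "p \<in> M \<Longrightarrow> X \<in> H p \<Longrightarrow> Y \<in> H p \<Longrightarrow> Z \<in> H p
    \<Longrightarrow> g p (a *\<^sub>R X + b *\<^sub>R Y) Z = a * g p X Z + b * g p Y Z"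
  using metric unfolding inner_product_on_def by blast

lemma g_pos: "p \<in> M \<Longrightarrow> X \<in> H p \<Longrightarrow> X \<noteq> 0 \<Longrightarrow> g p X X > 0"
  using metric unfolding inner_product_on_def by blast

lemma g_eq_0: "p \<in> M \<Longrightarrow> X \<in> H p \<Longrightarrow> g p X X = 0 \<Longrightarrow> X = 0"
  using g_pos by (metis less_irrefl)

end

abbreviation qc_idx :: "nat set" where "qc_idx \<equiv> {1, 2, 3}"

locale qc_local = qc_geometry M A n H g Q
  for M :: "'a::{t2_space,second_countable_topology} set"
    and A :: "('a, 'e::euclidean_space) chart set"
    and n H g Q +
  fixes U :: "'a set" and \<eta> :: "nat \<Rightarrow> ('a, 'e) form" and I :: "nat \<Rightarrow> 'a \<Rightarrow> 'e \<Rightarrow> 'e"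
    and \<xi> :: "nat \<Rightarrow> 'a \<Rightarrow> 'e"
  assumes frame: "qc_frame A H g Q U \<eta> I \<xi>"
begin

lemma
  shows U_open: "open U" and U_charts: "U \<subseteq> (\<Union>c\<in>A. fst c)"
    and eta_I_smooth: "\<forall>s\<in>qc_idx. smooth_form A U 1 (\<eta> s) \<and> smooth_endomorphism A H U (I s)"
    and H_kernel: "\<forall>p\<in>U. H p = {X. \<forall>s\<in>qc_idx. \<eta> s p [X] = 0}"
    and I_relations: "\<forall>p\<in>U. \<forall>X\<in>H p. (\<forall>s\<in>qc_idx. I s p (I s p X) = - X) \<and>
        I 1 p (I 2 p X) = I 3 p X \<and> I 2 p (I 1 p X) = - I 3 p X \<and>
        I 1 p (I 2 p (I 3 p X)) = - X"
    and metric_relations: "\<forall>p\<in>U. \<forall>s\<in>qc_idx. \<forall>X\<in>H p. \<forall>Y\<in>H p.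
        g p (I s p X) (I s p Y) = g p X Y \<and> 2 * g p (I s p X) Y = ext_d A (\<eta> s) p [X, Y]"
    and reeb: "reeb_fields A H U \<eta> \<xi>"
  by (insert frame, unfold qc_frame_def) (elim conjE, assumption)+

lemma U_subset: "U \<subseteq> M"
  using U_charts atlas unfolding smooth_atlas_def by blast

lemma eta_smooth: "s \<in> qc_idx \<Longrightarrow> smooth_form A U 1 (\<eta> s)"
  using eta_I_smooth by blast

lemma eta_linear:
  assumes "s \<in> qc_idx" and "p \<in> U"
  shows "linear (\<lambda>v. \<eta> s p [v])"
  using eta_smooth[OF assms(1)] assms(2) alternating_multilinear_1_linear
  unfolding smooth_form_def by blast

lemma H_iff: "p \<in> U \<Longrightarrow> X \<in> H p \<longleftrightarrow> (\<forall>s\<in>qc_idx. \<eta> s p [X] = 0)"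
  using H_kernel by blast

lemma eta_H: "p \<in> U \<Longrightarrow> X \<in> H p \<Longrightarrow> s \<in> qc_idx \<Longrightarrow> \<eta> s p [X] = 0"
  using H_iff by blast

lemma xi_smooth: "s \<in> qc_idx \<Longrightarrow> smooth_vector_field A U (\<xi> s)"
  using reeb unfolding reeb_fields_def by blast

lemma eta_xi: "p \<in> U \<Longrightarrow> s \<in> qc_idx \<Longrightarrow> k \<in> qc_idx \<Longrightarrow> \<eta> s p [\<xi> k p] = (if s = k then 1 else 0)"
  using reeb unfolding reeb_fields_def by blast

lemma reeb_swap: "p \<in> U \<Longrightarrow> s \<in> qc_idx \<Longrightarrow> k \<in> qc_idx \<Longrightarrow> X \<in> H p
    \<Longrightarrow> ext_d A (\<eta> k) p [\<xi> s p, X] = - ext_d A (\<eta> s) p [\<xi> k p, X]"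
  using reeb unfolding reeb_fields_def by blast

lemma reeb_self: "p \<in> U \<Longrightarrow> s \<in> qc_idx \<Longrightarrow> X \<in> H p \<Longrightarrow> ext_d A (\<eta> s) p [\<xi> s p, X] = 0"
  using reeb unfolding reeb_fields_def by blast

lemma ext_d_eta_antisym: "ext_d A (\<eta> s) p [u, v] = - ext_d A (\<eta> s) p [v, u]"
  unfolding ext_d_pair by (rule coord_d_antisym)

lemma bilinear_coord_d_eta:
  assumes "s \<in> qc_idx" and "c \<in> A" and "x \<in> snd c ` (U \<inter> fst c)"
  shows "bilinear (coord_d (\<lambda>y v. chart_rep A c (\<eta> s) y [v]) x)"
  by (rule bilinear_coord_d[OF open_chart_image[OF assms(2) U_open] assms(3)])
    (auto intro: chart_rep_linear[OF eta_smooth[OF assms(1)] U_subset assms(2)]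
      smooth_on_differentiable[OF chart_rep_smooth[OF eta_smooth[OF assms(1)] assms(2)] assms(3)])

lemma bilinear_ext_d_eta:
  assumes "s \<in> qc_idx" and "p \<in> U"
  shows "bilinear (\<lambda>u v. ext_d A (\<eta> s) p [u, v])"
  unfolding ext_d_pair
  by (rule bilinear_coord_d_eta[OF assms(1)]) (use assms(2) U_subset chart_at_mem in blast)+

lemma I_H: "p \<in> U \<Longrightarrow> s \<in> qc_idx \<Longrightarrow> X \<in> H p \<Longrightarrow> I s p X \<in> H p"
  using eta_I_smooth unfolding smooth_endomorphism_def endomorphism_on_def by blast

lemma I_lin: "p \<in> U \<Longrightarrow> s \<in> qc_idx \<Longrightarrow> X \<in> H p \<Longrightarrow> Y \<in> H p
    \<Longrightarrow> I s p (a *\<^sub>R X + b *\<^sub>R Y) = a *\<^sub>R I s p X + b *\<^sub>R I s p Y"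
  using eta_I_smooth unfolding smooth_endomorphism_def endomorphism_on_def by blast

lemma I_uminus: "p \<in> U \<Longrightarrow> s \<in> qc_idx \<Longrightarrow> X \<in> H p \<Longrightarrow> I s p (- X) = - I s p X"
  using I_lin[of p s X X "-1" 0] by simp

text \<open>The remaining products follow by writing \<open>I 3\<close> as \<open>I 1\<close> after
  \<open>I 2\<close>. Signs can be pulled out only on \<open>H\<close>, where the endomorphisms are
  linear, hence the membership facts.\<close>

lemma I_table:
  assumes "p \<in> U" and "X \<in> H p"
  shows "s \<in> qc_idx \<Longrightarrow> I s p (I s p X) = - X"
    and "I 1 p (I 2 p X) = I 3 p X" and "I 2 p (I 1 p X) = - I 3 p X"
    and "I 1 p (I 3 p X) = - I 2 p X" and "I 3 p (I 1 p X) = I 2 p X"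
    and "I 2 p (I 3 p X) = I 1 p X" and "I 3 p (I 2 p X) = - I 1 p X"
proof -
  have basic: "\<forall>X\<in>H p. (\<forall>s\<in>qc_idx. I s p (I s p X) = - X) \<and> I 1 p (I 2 p X) = I 3 p X \<and>
      I 2 p (I 1 p X) = - I 3 p X"
    using I_relations assms(1) by blast
  show sq: "s \<in> qc_idx \<Longrightarrow> I s p (I s p X) = - X" for s using basic assms(2) by blast
  show I12: "I 1 p (I 2 p X) = I 3 p X" and "I 2 p (I 1 p X) = - I 3 p X"
    using basic assms(2) by blast+
  have H: "I s p X \<in> H p" if "s \<in> qc_idx" for s using I_H assms that by blast
  show I13: "I 1 p (I 3 p X) = - I 2 p X"
    using basic H[of 2] I12 by (metis insertI1 insertI2)
  show I32: "I 3 p (I 2 p X) = - I 1 p X"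
  proof -
    have "I 3 p (I 2 p X) = I 1 p (I 2 p (I 2 p X))" using basic H[of 2] by simp
    then show ?thesis using sq[of 2] I_uminus[OF assms(1) _ assms(2)] by simp
  qed
  show "I 2 p (I 3 p X) = I 1 p X"
  proof -
    have "I 2 p (I 3 p X) = I 2 p (I 1 p (I 2 p X))" using I12 by simp
    also have "\<dots> = - I 3 p (I 2 p X)" using basic H[of 2] by simp
    finally show ?thesis using I32 by simp
  qed
  show "I 3 p (I 1 p X) = I 2 p X"
  proof -
    have "I 3 p (I 1 p X) = I 1 p (I 2 p (I 1 p X))" using basic H[of 1] by simp
    also have "\<dots> = I 1 p (- I 3 p X)" using basic assms(2) by simp
    also have "\<dots> = - I 1 p (I 3 p X)" using I_uminus[OF assms(1) _ H[of 3]] by simp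
    finally show ?thesis using I13 by simp
  qed
qed

lemma g_I: "p \<in> U \<Longrightarrow> s \<in> qc_idx \<Longrightarrow> X \<in> H p \<Longrightarrow> Y \<in> H p \<Longrightarrow> g p (I s p X) (I s p Y) = g p X Y"
  using metric_relations by blast

lemma g_I_ext_d: "p \<in> U \<Longrightarrow> s \<in> qc_idx \<Longrightarrow> X \<in> H p \<Longrightarrow> Y \<in> H p
    \<Longrightarrow> 2 * g p (I s p X) Y = ext_d A (\<eta> s) p [X, Y]"
  using metric_relations by blast

lemma g_I_self:
  assumes "p \<in> U" "s \<in> qc_idx" "X \<in> H p"
  shows "g p (I s p X) X = 0"
  using g_I_ext_d[OF assms assms(3)] ext_d_eta_antisym[of s p X X] by simp

text \<open>Each mixed product reduces, by the isometry property and the quaternion relations, to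
  some \<open>g p (I r p Y) Y\<close> up to sign, and that vanishes because the exterior derivative
  of a contact form is antisymmetric.\<close>

lemma g_I_I:
  assumes "p \<in> U" "s \<in> qc_idx" "k \<in> qc_idx" "X \<in> H p"
  shows "g p (I s p X) (I k p X) = (if s = k then g p X X else 0)"
proof -
  have pM: "p \<in> M" using assms(1) U_subset by blast
  have H: "I s p X \<in> H p" if "s \<in> qc_idx" for s using I_H assms that by blast
  have "g p (I 1 p X) (I 2 p X) = g p (I 1 p (I 1 p X)) (I 1 p (I 2 p X))"
    using g_I[OF assms(1), of 1] H by simp
  \<comment> \<open>Minus \<open>X\<close> is written as a combination of two vectors to fit
    \<open>g_lin\<close>.\<close>
  also have "\<dots> = g p ((-1) *\<^sub>R X + 0 *\<^sub>R X) (I 3 p X)"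
    using I_table[OF assms(1,4)] by simp
  also have "\<dots> = - g p (I 3 p X) X"
    unfolding g_lin[OF pM assms(4,4) H[of 3, simplified]] using g_sym[OF pM assms(4) H[of 3]] by simp
  finally have g12: "g p (I 1 p X) (I 2 p X) = 0" using g_I_self[OF assms(1) _ assms(4)] by simp
  have g23: "g p (I 2 p X) (I 3 p X) = 0"
    using g_I_self[OF assms(1) _ H[of 2], of 1] I_table(2)[OF assms(1,4)]
      g_sym[OF pM H[of 2] H[of 3]] by simp
  have g13: "g p (I 1 p X) (I 3 p X) = 0"
    using g_I[OF assms(1) _ assms(4) H[of 2], of 1] I_table(2)[OF assms(1,4)]
      g_I_self[OF assms(1) _ assms(4), of 2] g_sym[OF pM assms(4) H[of 2]] by simp
  note sym = g_sym[OF pM H[of 2] H[of 1]] g_sym[OF pM H[of 3] H[of 1]] g_sym[OF pM H[of 3] H[of 2]]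
  show ?thesis
    using assms(2,3) g12 g23 g13 sym g_I[OF assms(1) _ assms(4,4)] by auto
qed

section \<open>Horizontal projection and the difference of the two 4-forms\<close>

lemma horizontal_sum: "horizontal \<eta> \<xi> p X
    = X - (\<eta> 1 p [X] *\<^sub>R \<xi> 1 p + \<eta> 2 p [X] *\<^sub>R \<xi> 2 p + \<eta> 3 p [X] *\<^sub>R \<xi> 3 p)"
  unfolding horizontal_def by simp

lemma horizontal_H:
  assumes "p \<in> U"
  shows "horizontal \<eta> \<xi> p X \<in> H p"
proof -
  have "\<eta> s p [horizontal \<eta> \<xi> p X] = 0" if s: "s \<in> qc_idx" for s
  proof -
    note lin = eta_linear[OF s assms]
    have "\<eta> s p [horizontal \<eta> \<xi> p X] = \<eta> s p [X] - (\<eta> 1 p [X] * \<eta> s p [\<xi> 1 p]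
        + \<eta> 2 p [X] * \<eta> s p [\<xi> 2 p] + \<eta> 3 p [X] * \<eta> s p [\<xi> 3 p])"
      unfolding horizontal_sum
      by (simp add: linear_diff[OF lin] linear_add[OF lin] linear_cmul[OF lin])
    then show ?thesis using s eta_xi[OF assms s] by auto
  qed
  then show ?thesis using H_iff[OF assms] by blast
qed

lemma omega_pair: "qc_omega A \<eta> \<xi> s p [u, v]
    = ext_d A (\<eta> s) p [horizontal \<eta> \<xi> p u, horizontal \<eta> \<xi> p v] / 2"
  unfolding qc_omega_def by simp

lemma omega_antisym: "qc_omega A \<eta> \<xi> s p [u, v] = - qc_omega A \<eta> \<xi> s p [v, u]"
  unfolding omega_pair using ext_d_eta_antisym[of s p "horizontal \<eta> \<xi> p u"] by simp

text \<open>Splitting both arguments into horizontal and vertical parts gives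
  \<open>2 \<omega>\<close> on the horizontal parts plus terms containing \<open>\<eta> j\<close> or
  \<open>\<eta> k\<close>, which the other factor kills. The set equation \<open>idx\<close> covers
  all cyclic cases at once.\<close>

lemma ext_d_eta_wedge:
  assumes p: "p \<in> U" and idx: "{i, j, k} = qc_idx"
  shows "wedge22 (\<lambda>u v. ext_d A (\<eta> i) p [u, v]) (wedge11 (\<lambda>v. \<eta> j p [v]) (\<lambda>v. \<eta> k p [v])) a b c d
    = 2 * wedge22 (\<lambda>u v. qc_omega A \<eta> \<xi> i p [u, v]) (wedge11 (\<lambda>v. \<eta> j p [v]) (\<lambda>v. \<eta> k p [v])) a b c d"
proof -
  define B where "B u v = ext_d A (\<eta> i) p [u, v]" for u v
  define h where "h = horizontal \<eta> \<xi> p"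
  define \<theta> where "\<theta> s v = \<eta> s p [v]" for s v
  have i: "i \<in> qc_idx" using idx by blast
  have distinct: "i \<noteq> j" "i \<noteq> k" "j \<noteq> k" 
  proof -
    have "card {i, j, k} = 3" unfolding idx by simp
    then show "i \<noteq> j" "i \<noteq> k" "j \<noteq> k" by (auto simp: card_insert_if split: if_splits)
  qed
  have bil: "bilinear B" unfolding B_def by (rule bilinear_ext_d_eta[OF i p])
  have anti: "B u v = - B v u" for u v unfolding B_def by (rule ext_d_eta_antisym)
  have zero: "B u u = 0" for u using anti[of u u] by simp
  \<comment> \<open>With \<open>B (\<xi> i p) (\<xi> i p) = 0\<close>, this removes every term
    involving a Reeb field that has no factor \<open>\<theta> j\<close> or
    \<open>\<theta> k\<close>.\<close>
  have reeb0: "B (\<xi> i p) (h v) = 0" "B (h v) (\<xi> i p) = 0" for v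
    using reeb_self[OF p i horizontal_H[OF p]] anti[of "h v" "\<xi> i p"] by (simp_all add: B_def h_def)
  have split: "v = h v + (\<theta> i v *\<^sub>R \<xi> i p + \<theta> j v *\<^sub>R \<xi> j p + \<theta> k v *\<^sub>R \<xi> k p)" for v
  proof -
    have "h v = v - (\<Sum>s\<in>{i, j, k}. \<theta> s v *\<^sub>R \<xi> s p)"
      unfolding h_def horizontal_def \<theta>_def idx ..
    then show ?thesis using distinct by (simp add: add.assoc)
  qed
  \<comment> \<open>The cofactors of \<open>\<theta> j\<close> and \<open>\<theta> k\<close>. The
    term with \<open>B (\<xi> j p) (\<xi> k p)\<close> contains both and is assigned to
    \<open>m\<close> alone, so that it is counted once.\<close>
  define m where "m v = B (\<xi> j p) (h v) - \<theta> i v * B (\<xi> i p) (\<xi> j p) + \<theta> k v * B (\<xi> j p) (\<xi> k p)" for v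
  define m' where "m' v = B (\<xi> k p) (h v) - \<theta> i v * B (\<xi> i p) (\<xi> k p)" for v
  have "B u v = 2 * qc_omega A \<eta> \<xi> i p [u, v] + wedge11 (\<theta> j) m u v + wedge11 (\<theta> k) m' u v" for u v
  proof -
    have "B u v = B (h u + (\<theta> i u *\<^sub>R \<xi> i p + \<theta> j u *\<^sub>R \<xi> j p + \<theta> k u *\<^sub>R \<xi> k p))
        (h v + (\<theta> i v *\<^sub>R \<xi> i p + \<theta> j v *\<^sub>R \<xi> j p + \<theta> k v *\<^sub>R \<xi> k p))"
      using split[of u] split[of v] by simp
    also have "\<dots> = B (h u) (h v) + wedge11 (\<theta> j) m u v + wedge11 (\<theta> k) m' u v"
      unfolding wedge11_def m_def m'_def
      by (simp add: bilinear_ladd[OF bil] bilinear_radd[OF bil] bilinear_lmul[OF bil]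
          bilinear_rmul[OF bil] reeb0 zero anti[of "h u" "\<xi> j p"] anti[of "h u" "\<xi> k p"]
          anti[of "\<xi> j p" "\<xi> i p"] anti[of "\<xi> k p" "\<xi> i p"] anti[of "\<xi> k p" "\<xi> j p"] algebra_simps)
    also have "B (h u) (h v) = 2 * qc_omega A \<eta> \<xi> i p [u, v]"
      unfolding omega_pair B_def h_def by simp
    finally show ?thesis .
  qed
  from wedge22_cancel[OF this] show ?thesis
    unfolding B_def \<theta>_def by (simp add: wedge22_def algebra_simps)
qed

lemma local_Omega_wedge22: "local_Omega A \<eta> \<xi> p [a, b, c, d]
    = wedge22 (\<lambda>u v. qc_omega A \<eta> \<xi> 1 p [u, v]) (\<lambda>u v. qc_omega A \<eta> \<xi> 1 p [u, v]) a b c d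
      + wedge22 (\<lambda>u v. qc_omega A \<eta> \<xi> 2 p [u, v]) (\<lambda>u v. qc_omega A \<eta> \<xi> 2 p [u, v]) a b c d
      + wedge22 (\<lambda>u v. qc_omega A \<eta> \<xi> 3 p [u, v]) (\<lambda>u v. qc_omega A \<eta> \<xi> 3 p [u, v]) a b c d"
proof -
  have "wedge 2 2 (qc_omega A \<eta> \<xi> s) (qc_omega A \<eta> \<xi> s) p [a, b, c, d]
    = wedge22 (\<lambda>u v. qc_omega A \<eta> \<xi> s p [u, v]) (\<lambda>u v. qc_omega A \<eta> \<xi> s p [u, v]) a b c d" for s
    by (rule wedge_2_2) (rule omega_antisym)+
  then show ?thesis unfolding local_Omega_def Let_def by simp
qed

text \<open>The coefficient 2 in front of the mixed terms is absorbed by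
  \<open>ext_d_eta_wedge\<close>, which replaces \<open>2 \<omega>\<close> by the exterior
  derivative of the contact form.\<close>

lemma local_Omega_Q_diff:
  assumes p: "p \<in> U"
  shows "local_Omega_Q A \<eta> \<xi> p [a, b, c, d] = local_Omega A \<eta> \<xi> p [a, b, c, d]
      + (wedge22 (\<lambda>u v. ext_d A (\<eta> 1) p [u, v]) (wedge11 (\<lambda>v. \<eta> 2 p [v]) (\<lambda>v. \<eta> 3 p [v])) a b c d
       + wedge22 (\<lambda>u v. ext_d A (\<eta> 2) p [u, v]) (wedge11 (\<lambda>v. \<eta> 3 p [v]) (\<lambda>v. \<eta> 1 p [v])) a b c d
       + wedge22 (\<lambda>u v. ext_d A (\<eta> 3) p [u, v]) (wedge11 (\<lambda>v. \<eta> 1 p [v]) (\<lambda>v. \<eta> 2 p [v])) a b c d)"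
proof -
  have anti: "wedge 1 1 \<alpha> \<beta> p [u, v] = - wedge 1 1 \<alpha> \<beta> p [v, u]" for \<alpha> \<beta> :: "('a, 'e) form" and u v
    unfolding wedge_1_1 wedge11_def by simp
  have idx: "{2, 3, 1} = qc_idx" "{3, 1, 2} = qc_idx" by auto
  note cyc = ext_d_eta_wedge[OF p refl] ext_d_eta_wedge[OF p idx(1)] ext_d_eta_wedge[OF p idx(2)]
  have "wedge 2 2 (qc_omega A \<eta> \<xi> s) (wedge 1 1 \<alpha> \<beta>) p [a, b, c, d]
    = wedge22 (\<lambda>u v. qc_omega A \<eta> \<xi> s p [u, v]) (wedge11 (\<lambda>v. \<alpha> p [v]) (\<lambda>v. \<beta> p [v])) a b c d"
    for s \<alpha> \<beta>
    unfolding wedge_1_1[symmetric] by (rule wedge_2_2) (rule omega_antisym anti)+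
  then show ?thesis
    unfolding local_Omega_Q_def local_Omega_def Let_def cyc by simp
qed

end

section \<open>The two 4-forms in a fixed chart\<close>

context qc_local
begin

definition eta_c :: "('a, 'e) chart \<Rightarrow> nat \<Rightarrow> 'e \<Rightarrow> 'e \<Rightarrow> real" where
  "eta_c c s y v = chart_rep A c (\<eta> s) y [v]"

text \<open>The components in the chart \<open>c\<close>, in exactly the form in which
  \<open>smooth_vector_field\<close> declares them smooth.\<close>

definition xi_c :: "('a, 'e) chart \<Rightarrow> nat \<Rightarrow> 'e \<Rightarrow> 'e" where
  "xi_c c s y = (let q = chart_inv c y in change_coord (chart_at A q) c q (\<xi> s q))"

definition horizontal_c :: "('a, 'e) chart \<Rightarrow> 'e \<Rightarrow> 'e \<Rightarrow> 'e" where
  "horizontal_c c y u = u - (eta_c c 1 y u *\<^sub>R xi_c c 1 y + eta_c c 2 y u *\<^sub>R xi_c c 2 y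
     + eta_c c 3 y u *\<^sub>R xi_c c 3 y)"

lemma eta_c_smooth:
  "c \<in> A \<Longrightarrow> s \<in> qc_idx \<Longrightarrow> smooth_on (snd c ` (U \<inter> fst c)) (\<lambda>y. eta_c c s y v)"
  unfolding eta_c_def by (rule chart_rep_smooth[OF eta_smooth])

lemma xi_c_smooth: "c \<in> A \<Longrightarrow> s \<in> qc_idx \<Longrightarrow> smooth_on (snd c ` (U \<inter> fst c)) (xi_c c s)"
  using xi_smooth unfolding smooth_vector_field_def xi_c_def by blast

lemma eta_c_linear:
  "c \<in> A \<Longrightarrow> s \<in> qc_idx \<Longrightarrow> y \<in> snd c ` (U \<inter> fst c) \<Longrightarrow> linear (eta_c c s y)"
  unfolding eta_c_def by (rule chart_rep_linear[OF eta_smooth U_subset])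

context
  fixes c q
  assumes c: "c \<in> A" and q: "q \<in> U" "q \<in> fst c"
begin

lemma chart_at_q: "chart_at A q \<in> A" "q \<in> fst (chart_at A q)"
  using chart_at_mem q U_subset by blast+

lemma eta_c_chart: "eta_c c s (snd c q) v = \<eta> s q [change_coord c (chart_at A q) q v]"
  unfolding eta_c_def by (simp add: chart_rep_chart[OF c q(2)])

lemma change_coord_xi_c: "change_coord c (chart_at A q) q (xi_c c s (snd c q)) = \<xi> s q"
  unfolding xi_c_def Let_def chart_inv_chart[OF c q(2)]
  using change_coord_trans[OF chart_at_q(1) c chart_at_q(1) chart_at_q(2) q(2) chart_at_q(2)]
    change_coord_self[OF chart_at_q] by simp

lemma horizontal_change_coord: "horizontal \<eta> \<xi> q (change_coord c (chart_at A q) q u)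
    = change_coord c (chart_at A q) q (horizontal_c c (snd c q) u)"
proof -
  have lin: "linear (change_coord c (chart_at A q) q)"
    by (rule linear_change_coord[OF c chart_at_q(1) q(2) chart_at_q(2)])
  show ?thesis
    unfolding horizontal_sum horizontal_c_def eta_c_chart
    by (simp add: linear_diff[OF lin] linear_add[OF lin] linear_cmul[OF lin] change_coord_xi_c)
qed

lemma ext_d_eta_chart: "s \<in> qc_idx \<Longrightarrow>
    ext_d A (\<eta> s) q [change_coord c (chart_at A q) q u, change_coord c (chart_at A q) q v]
      = coord_d (eta_c c s) (snd c q) u v"
  using ext_d_change_coord[OF eta_smooth U_subset U_open c q] unfolding eta_c_def .

lemma omega_chart: "s \<in> qc_idx \<Longrightarrow>
    qc_omega A \<eta> \<xi> s q [change_coord c (chart_at A q) q u, change_coord c (chart_at A q) q v]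
      = coord_d (eta_c c s) (snd c q) (horizontal_c c (snd c q) u) (horizontal_c c (snd c q) v) / 2"
  unfolding omega_pair horizontal_change_coord by (simp add: ext_d_eta_chart)

text \<open>The Leibniz expansion of the derivative of the triple product of contact forms is, term
  by term, the cyclic sum of \<open>local_Omega_Q_diff\<close>. So the difference is exact in the
  chart.\<close>

lemma chart_rep_Omega_Q_diff:
  "chart_rep A c (local_Omega_Q A \<eta> \<xi>) (snd c q) [u, v, w, z]
    = chart_rep A c (local_Omega A \<eta> \<xi>) (snd c q) [u, v, w, z]
      + coord_d3 (\<lambda>y. volume3 (eta_c c 1 y) (eta_c c 2 y) (eta_c c 3 y)) (snd c q) u v w z"
proof -
  have diff: "(\<lambda>y. eta_c c s y v) differentiable (at (snd c q))" if "s \<in> qc_idx" for s v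
    by (rule smooth_on_differentiable[OF eta_c_smooth[OF c that]]) (use q in blast)
  have "coord_d3 (\<lambda>y. volume3 (eta_c c 1 y) (eta_c c 2 y) (eta_c c 3 y)) (snd c q) u v w z
    = wedge22 (coord_d (eta_c c 1) (snd c q)) (wedge11 (eta_c c 2 (snd c q)) (eta_c c 3 (snd c q))) u v w z
      + wedge22 (coord_d (eta_c c 2) (snd c q)) (wedge11 (eta_c c 3 (snd c q)) (eta_c c 1 (snd c q))) u v w z
      + wedge22 (coord_d (eta_c c 3) (snd c q)) (wedge11 (eta_c c 1 (snd c q)) (eta_c c 2 (snd c q))) u v w z"
    by (rule coord_d3_volume3) (simp_all add: diff)
  then show ?thesis
    by (simp add: chart_rep_chart[OF c q(2)] local_Omega_Q_diff[OF q(1)] wedge22_def wedge11_def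
        ext_d_eta_chart eta_c_chart)
qed

end

lemma differentiable_horizontal_c:
  assumes c: "c \<in> A" and y: "y \<in> snd c ` (U \<inter> fst c)"
  shows "(\<lambda>y. horizontal_c c y u) differentiable (at y)"
  unfolding horizontal_c_def
  by (auto intro!: differentiable_diff differentiable_add differentiable_scaleR
      smooth_on_differentiable[OF eta_c_smooth[OF c] y] smooth_on_differentiable[OF xi_c_smooth[OF c] y])

lemma differentiable_omega_c:
  assumes c: "c \<in> A" and s: "s \<in> qc_idx" and y: "y \<in> snd c ` (U \<inter> fst c)"
  shows "(\<lambda>y. coord_d (eta_c c s) y (horizontal_c c y u) (horizontal_c c y v)) differentiable (at y)"
proof -
  let ?W = "snd c ` (U \<inter> fst c)"
  have W: "open ?W" by (rule open_chart_image[OF c U_open])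
  have bil: "bilinear (coord_d (eta_c c s) x)" if "x \<in> ?W" for x
    using bilinear_coord_d_eta[OF s c that] unfolding eta_c_def .
  have base: "(\<lambda>y. coord_d (eta_c c s) y a b) differentiable (at y)" for a b
    unfolding coord_d_def
    by (intro differentiable_diff smooth_on_differentiable[OF smooth_on_derivative[OF eta_c_smooth[OF c s]] y])
  \<comment> \<open>The projected arguments move with \<open>y\<close> as well, so
    \<open>differentiable_eval\<close> is applied once for each slot.\<close>
  have one: "(\<lambda>y. coord_d (eta_c c s) y (horizontal_c c y u) b) differentiable (at y)" for b
    by (rule differentiable_eval[where F = "\<lambda>y a. coord_d (eta_c c s) y a b", OF W y])
      (use bil in \<open>auto simp: bilinear_def base differentiable_horizontal_c[OF c y]\<close>)
  show ?thesis
    by (rule differentiable_eval[where F = "\<lambda>y. coord_d (eta_c c s) y (horizontal_c c y u)", OF W y])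
      (use bil in \<open>auto simp: bilinear_def one differentiable_horizontal_c[OF c y]\<close>)
qed

text \<open>The chart expression is quadratic in the \<open>\<omega>\<close>. Its differentiability
  is what permits splitting the derivative of the fundamental form plus the exact term.\<close>

lemma differentiable_chart_rep_Omega:
  assumes c: "c \<in> A" and y: "y \<in> snd c ` (U \<inter> fst c)"
  shows "(\<lambda>y. chart_rep A c (local_Omega A \<eta> \<xi>) y [u, v, w, z]) differentiable (at y)"
proof -
  define G where "G s y a b = coord_d (eta_c c s) y (horizontal_c c y a) (horizontal_c c y b) / 2"
    for s y a b
  have G: "(\<lambda>y. G s y a b) differentiable (at y)" if "s \<in> qc_idx" for s a b
    unfolding G_def using differentiable_omega_c[OF c that y] by simp
  show ?thesis
  proof (rule differentiable_cong_open[OF open_chart_image[OF c U_open] y])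
    show "(\<lambda>y. wedge22 (G 1 y) (G 1 y) u v w z + wedge22 (G 2 y) (G 2 y) u v w z
        + wedge22 (G 3 y) (G 3 y) u v w z) differentiable (at y)"
      unfolding wedge22_def by (simp add: G)
    fix x assume "x \<in> snd c ` (U \<inter> fst c)"
    then obtain q where q: "q \<in> U" "q \<in> fst c" "x = snd c q" by blast
    show "wedge22 (G 1 x) (G 1 x) u v w z + wedge22 (G 2 x) (G 2 x) u v w z
        + wedge22 (G 3 x) (G 3 x) u v w z = chart_rep A c (local_Omega A \<eta> \<xi>) x [u, v, w, z]"
      unfolding q(3)
      by (simp add: chart_rep_chart[OF c q(2)] local_Omega_wedge22 wedge22_def G_def
          omega_chart[OF c q(1,2)])
  qed
qed

lemma ext_d_local_Omega_Q:
  assumes p: "p \<in> U" and vs: "length vs = 5"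
  shows "ext_d A (local_Omega_Q A \<eta> \<xi>) p vs = ext_d A (local_Omega A \<eta> \<xi>) p vs"
proof -
  define c where "c = chart_at A p"
  define W where "W = snd c ` (U \<inter> fst c)"
  define x where "x = snd c p"
  define F where "F = (\<lambda>y. volume3 (eta_c c 1 y) (eta_c c 2 y) (eta_c c 3 y))"
  have c: "c \<in> A" "p \<in> fst c" unfolding c_def using chart_at_mem p U_subset by blast+
  have W: "open W" "x \<in> W" unfolding W_def x_def using open_chart_image[OF c(1) U_open] p c by auto
  have F: "smooth_on W (\<lambda>y. F y a b d)" for a b d
    unfolding F_def using W(1)
    by (rule smooth_on_volume3) (simp_all add: W_def eta_c_smooth[OF c(1)])
  have dF: "(\<lambda>y. coord_d3 F y a b d e) differentiable (at x)" for a b d e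
    unfolding coord_d3_def
    by (intro differentiable_diff differentiable_add
        smooth_on_differentiable[OF smooth_on_derivative[OF F] W(2)])
  have D: "frechet_derivative (\<lambda>y. chart_rep A c (local_Omega_Q A \<eta> \<xi>) y [a, b, d, e]) (at x) v
    = frechet_derivative (\<lambda>y. chart_rep A c (local_Omega A \<eta> \<xi>) y [a, b, d, e]) (at x) v
      + frechet_derivative (\<lambda>y. coord_d3 F y a b d e) (at x) v" for a b d e v
  proof -
    have "frechet_derivative (\<lambda>y. chart_rep A c (local_Omega_Q A \<eta> \<xi>) y [a, b, d, e]) (at x)
      = frechet_derivative (\<lambda>y. chart_rep A c (local_Omega A \<eta> \<xi>) y [a, b, d, e]
          + coord_d3 F y a b d e) (at x)"
      by (rule frechet_derivative_cong_open[OF W])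
        (auto simp: W_def F_def chart_rep_Omega_Q_diff[OF c(1)])
    then show ?thesis
      using differentiable_chart_rep_Omega[OF c(1) W(2)[unfolded W_def]]
      by (simp add: frechet_derivative_add_at dF)
  qed
  have "\<exists>v0 v1 v2 v3 v4. vs = [v0, v1, v2, v3, v4]"
    using vs by (auto simp: numeral_eq_Suc length_Suc_conv)
  then obtain v0 v1 v2 v3 v4 where vs5: "vs = [v0, v1, v2, v3, v4]" by blast
  \<comment> \<open>The five summands of \<open>ext_d\<close>, in the shape of
    \<open>coord_d_coord_d3\<close>; the same expansion serves both forms.\<close>
  have expand: "ext_d A \<alpha> p vs
    = frechet_derivative (\<lambda>y. chart_rep A c \<alpha> y [v1, v2, v3, v4]) (at x) v0
    - frechet_derivative (\<lambda>y. chart_rep A c \<alpha> y [v0, v2, v3, v4]) (at x) v1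
    + frechet_derivative (\<lambda>y. chart_rep A c \<alpha> y [v0, v1, v3, v4]) (at x) v2
    - frechet_derivative (\<lambda>y. chart_rep A c \<alpha> y [v0, v1, v2, v4]) (at x) v3
    + frechet_derivative (\<lambda>y. chart_rep A c \<alpha> y [v0, v1, v2, v3]) (at x) v4" for \<alpha>
    unfolding ext_d_def Let_def vs5 c_def[symmetric] x_def[symmetric]
    by (simp add: lessThan_Suc)
  show ?thesis
    unfolding expand D using coord_d_coord_d3[where F = F and a = v0 and b = v1 and c = v2 and d = v3 and e = v4, OF W F]
    by linarith
qed

end

section \<open>Independence of the frame\<close>

lemma length_2_conv: "length l = 2 \<Longrightarrow> \<exists>u v. l = [u, v]"
  by (auto simp: numeral_eq_Suc length_Suc_conv)

text \<open>A right inverse of a square matrix is also a left inverse.\<close>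

lemma orthonormal_columns3:
  fixes a :: "nat \<Rightarrow> nat \<Rightarrow> real"
  assumes rows: "\<And>s k. s \<in> qc_idx \<Longrightarrow> k \<in> qc_idx
    \<Longrightarrow> a s 1 * a k 1 + a s 2 * a k 2 + a s 3 * a k 3 = (if s = k then 1 else 0)"
    and "t \<in> qc_idx" "u \<in> qc_idx"
  shows "a 1 t * a 1 u + a 2 t * a 2 u + a 3 t * a 3 u = (if t = u then 1 else 0)"
proof -
  \<comment> \<open>In the type \<open>3\<close> the numeral 3 equals 0, so the indices are matched
    by hand.\<close>
  define f :: "3 \<Rightarrow> nat" where "f i = (if i = 1 then 1 else if i = 2 then 2 else 3)" for i
  have ne: "(1::3) \<noteq> 2" "(1::3) \<noteq> 3" "(2::3) \<noteq> 3" by simp_all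
  have f: "f 1 = 1" "f 2 = 2" "f 3 = 3" using ne by (simp_all add: f_def)
  define P :: "real^3^3" where "P = (\<chi> i j. a (f i) (f j))"
  have "P ** transpose P = mat 1"
    unfolding vec_eq_iff matrix_matrix_mult_def transpose_def mat_def forall_3 sum_3
    using rows ne ne[symmetric] by (simp add: P_def f)
  then have "transpose P ** P = mat 1" by (simp add: matrix_left_right_inverse)
  then have "\<forall>i j. (\<Sum>k\<in>UNIV. P $ k $ i * P $ k $ j) = (if i = j then 1 else 0)"
    unfolding vec_eq_iff matrix_matrix_mult_def transpose_def mat_def by simp
  then show ?thesis
    unfolding sum_3 forall_3 using assms(2,3) ne ne[symmetric] by (auto simp: P_def f)
qed

text \<open>The third row is the cross product of the first two, which are orthonormal; hence each
  row is the cross product of the next two in cyclic order. For a rotation, cofactors equal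
  entries.\<close>

lemma rotation_cofactors:
  fixes a :: "nat \<Rightarrow> nat \<Rightarrow> real"
  assumes rows: "\<And>s k. s \<in> qc_idx \<Longrightarrow> k \<in> qc_idx
    \<Longrightarrow> a s 1 * a k 1 + a s 2 * a k 2 + a s 3 * a k 3 = (if s = k then 1 else 0)"
    and third: "a 3 1 = a 1 2 * a 2 3 - a 1 3 * a 2 2" "a 3 2 = a 1 3 * a 2 1 - a 1 1 * a 2 3"
      "a 3 3 = a 1 1 * a 2 2 - a 1 2 * a 2 1"
  shows "a 1 1 = a 2 2 * a 3 3 - a 2 3 * a 3 2" "a 1 2 = a 2 3 * a 3 1 - a 2 1 * a 3 3"
      "a 1 3 = a 2 1 * a 3 2 - a 2 2 * a 3 1"
    and "a 2 1 = a 3 2 * a 1 3 - a 3 3 * a 1 2" "a 2 2 = a 3 3 * a 1 1 - a 3 1 * a 1 3"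
      "a 2 3 = a 3 1 * a 1 2 - a 3 2 * a 1 1"
proof -
  have r: "a 1 1 * a 1 1 + a 1 2 * a 1 2 + a 1 3 * a 1 3 = 1"
    "a 2 1 * a 2 1 + a 2 2 * a 2 2 + a 2 3 * a 2 3 = 1"
    "a 1 1 * a 2 1 + a 1 2 * a 2 2 + a 1 3 * a 2 3 = 0"
    using rows[of 1 1] rows[of 2 2] rows[of 1 2] by simp_all
  show "a 1 1 = a 2 2 * a 3 3 - a 2 3 * a 3 2" "a 1 2 = a 2 3 * a 3 1 - a 2 1 * a 3 3"
      "a 1 3 = a 2 1 * a 3 2 - a 2 2 * a 3 1"
     "a 2 1 = a 3 2 * a 1 3 - a 3 3 * a 1 2" "a 2 2 = a 3 3 * a 1 1 - a 3 1 * a 1 3"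
      "a 2 3 = a 3 1 * a 1 2 - a 3 2 * a 1 1"
    unfolding third using r by algebra+
qed

text \<open>Orthonormal columns preserve the pairing of the two triples, and this applies to each
  summand of \<open>wedge\<close>. Keeping \<open>\<alpha>\<close> and \<open>\<beta>\<close> apart
  covers both the squares of the \<open>\<omega>\<close> and their products with pairs of contact
  forms.\<close>

lemma wedge_sum_rotation:
  fixes \<alpha> \<beta> \<alpha>' \<beta>' :: "nat \<Rightarrow> ('a, 'e) form"
  assumes cols: "\<And>t u. t \<in> qc_idx \<Longrightarrow> u \<in> qc_idx
    \<Longrightarrow> a 1 t * a 1 u + a 2 t * a 2 u + a 3 t * a 3 u = (if t = u then 1 else (0::real))"
    and \<alpha>: "\<And>s l. s \<in> qc_idx \<Longrightarrow> length l = 2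
      \<Longrightarrow> \<alpha>' s p l = a s 1 * \<alpha> 1 p l + a s 2 * \<alpha> 2 p l + a s 3 * \<alpha> 3 p l"
    and \<beta>: "\<And>s l. s \<in> qc_idx \<Longrightarrow> length l = 2
      \<Longrightarrow> \<beta>' s p l = a s 1 * \<beta> 1 p l + a s 2 * \<beta> 2 p l + a s 3 * \<beta> 3 p l"
  shows "wedge 2 2 (\<alpha>' 1) (\<beta>' 1) p vs + wedge 2 2 (\<alpha>' 2) (\<beta>' 2) p vs + wedge 2 2 (\<alpha>' 3) (\<beta>' 3) p vs
    = wedge 2 2 (\<alpha> 1) (\<beta> 1) p vs + wedge 2 2 (\<alpha> 2) (\<beta> 2) p vs + wedge 2 2 (\<alpha> 3) (\<beta> 3) p vs"
proof -
  have key: "\<alpha>' 1 p l * \<beta>' 1 p m + \<alpha>' 2 p l * \<beta>' 2 p m + \<alpha>' 3 p l * \<beta>' 3 p m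
    = \<alpha> 1 p l * \<beta> 1 p m + \<alpha> 2 p l * \<beta> 2 p m + \<alpha> 3 p l * \<beta> 3 p m"
    if "length l = 2" "length m = 2" for l m
  proof -
    have c: "a 1 1 * a 1 1 + a 2 1 * a 2 1 + a 3 1 * a 3 1 = 1"
      "a 1 2 * a 1 2 + a 2 2 * a 2 2 + a 3 2 * a 3 2 = 1"
      "a 1 3 * a 1 3 + a 2 3 * a 2 3 + a 3 3 * a 3 3 = 1"
      "a 1 1 * a 1 2 + a 2 1 * a 2 2 + a 3 1 * a 3 2 = 0"
      "a 1 1 * a 1 3 + a 2 1 * a 2 3 + a 3 1 * a 3 3 = 0"
      "a 1 2 * a 1 3 + a 2 2 * a 2 3 + a 3 2 * a 3 3 = 0"
      using cols[of 1 1] cols[of 2 2] cols[of 3 3] cols[of 1 2] cols[of 1 3] cols[of 2 3] by simp_all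
    have e: "\<alpha>' 1 p l = a 1 1 * \<alpha> 1 p l + a 1 2 * \<alpha> 2 p l + a 1 3 * \<alpha> 3 p l"
      "\<alpha>' 2 p l = a 2 1 * \<alpha> 1 p l + a 2 2 * \<alpha> 2 p l + a 2 3 * \<alpha> 3 p l"
      "\<alpha>' 3 p l = a 3 1 * \<alpha> 1 p l + a 3 2 * \<alpha> 2 p l + a 3 3 * \<alpha> 3 p l"
      "\<beta>' 1 p m = a 1 1 * \<beta> 1 p m + a 1 2 * \<beta> 2 p m + a 1 3 * \<beta> 3 p m"
      "\<beta>' 2 p m = a 2 1 * \<beta> 1 p m + a 2 2 * \<beta> 2 p m + a 2 3 * \<beta> 3 p m"
      "\<beta>' 3 p m = a 3 1 * \<beta> 1 p m + a 3 2 * \<beta> 2 p m + a 3 3 * \<beta> 3 p m"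
      using \<alpha> \<beta> that by simp_all
    show ?thesis unfolding e using c by algebra
  qed
  have "(of_int (sign \<sigma>) * \<alpha>' 1 p (map (\<lambda>i. vs ! \<sigma> i) [0..<2]) * \<beta>' 1 p (map (\<lambda>i. vs ! \<sigma> i) [2..<2 + 2])
      + of_int (sign \<sigma>) * \<alpha>' 2 p (map (\<lambda>i. vs ! \<sigma> i) [0..<2]) * \<beta>' 2 p (map (\<lambda>i. vs ! \<sigma> i) [2..<2 + 2]))
      + of_int (sign \<sigma>) * \<alpha>' 3 p (map (\<lambda>i. vs ! \<sigma> i) [0..<2]) * \<beta>' 3 p (map (\<lambda>i. vs ! \<sigma> i) [2..<2 + 2])
    = (of_int (sign \<sigma>) * \<alpha> 1 p (map (\<lambda>i. vs ! \<sigma> i) [0..<2]) * \<beta> 1 p (map (\<lambda>i. vs ! \<sigma> i) [2..<2 + 2])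
      + of_int (sign \<sigma>) * \<alpha> 2 p (map (\<lambda>i. vs ! \<sigma> i) [0..<2]) * \<beta> 2 p (map (\<lambda>i. vs ! \<sigma> i) [2..<2 + 2]))
      + of_int (sign \<sigma>) * \<alpha> 3 p (map (\<lambda>i. vs ! \<sigma> i) [0..<2]) * \<beta> 3 p (map (\<lambda>i. vs ! \<sigma> i) [2..<2 + 2])" for \<sigma>
  proof -
    have "length (map (\<lambda>i. vs ! \<sigma> i) [0..<2]) = 2" "length (map (\<lambda>i. vs ! \<sigma> i) [2..<2 + 2]) = 2"
      by simp_all
    note k = key[OF this]
    show ?thesis
      unfolding mult.assoc distrib_left[symmetric] k ..
  qed
  then show ?thesis
    unfolding wedge_def add_divide_distrib[symmetric] sum.distrib[symmetric] by simp
qed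

section \<open>The transition matrix between two frames\<close>

locale qc_two_frames =
  F: qc_local M A n H g Q U \<eta> I \<xi> + F': qc_local M A n H g Q U' \<eta>' I' \<xi>'
  for M :: "'a::{t2_space,second_countable_topology} set"
    and A :: "('a, 'e::euclidean_space) chart set"
    and n H g Q U \<eta> I \<xi> U' \<eta>' I' \<xi>'
begin

text \<open>Being a pairing of a smooth form with a smooth field, it is differentiable in a
  chart.\<close>

definition rot :: "'a \<Rightarrow> nat \<Rightarrow> nat \<Rightarrow> real" where
  "rot q s t = \<eta>' s q [\<xi> t q]"

text \<open>The projection of \<open>v\<close> along the first frame lies in \<open>H\<close>, which
  is also the kernel of the second triple of contact forms; only the vertical part
  contributes.\<close>

lemma eta'_eq:
  assumes q: "q \<in> U" "q \<in> U'" and s: "s \<in> qc_idx"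
  shows "\<eta>' s q [v] = rot q s 1 * \<eta> 1 q [v] + rot q s 2 * \<eta> 2 q [v] + rot q s 3 * \<eta> 3 q [v]"
proof -
  note lin = F'.eta_linear[OF s q(2)]
  have "0 = \<eta>' s q [horizontal \<eta> \<xi> q v]"
    using F'.eta_H[OF q(2) F.horizontal_H[OF q(1)] s] by simp
  also have "\<dots> = \<eta>' s q [v] - (\<eta> 1 q [v] * rot q s 1 + \<eta> 2 q [v] * rot q s 2 + \<eta> 3 q [v] * rot q s 3)"
    unfolding F.horizontal_sum rot_def
    by (simp add: linear_diff[OF lin] linear_add[OF lin] linear_cmul[OF lin])
  finally show ?thesis by (simp add: algebra_simps)
qed

lemma rot_chart:
  assumes c: "c \<in> A" and q: "q \<in> U" "q \<in> fst c"
  shows "rot q s t = F'.eta_c c s (snd c q) (F.xi_c c t (snd c q))"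
  unfolding F'.eta_c_def F.atlas_manifold_axioms[THEN atlas_manifold.chart_rep_chart, OF c q(2)]
    rot_def by (simp add: F.change_coord_xi_c[OF c q])

context
  fixes p
  assumes p: "p \<in> U" "p \<in> U'"
begin

lemma p_M: "p \<in> M"
  using p F.U_subset by blast

lemma open_overlap: "open (snd (chart_at A p) ` ((U \<inter> U') \<inter> fst (chart_at A p)))"
  by (rule F.open_chart_image[OF F.chart_at_mem(1)[OF p_M] open_Int[OF F.U_open F'.U_open]])

lemma overlap: "snd (chart_at A p) p \<in> snd (chart_at A p) ` ((U \<inter> U') \<inter> fst (chart_at A p))"
  using p F.chart_at_mem(2)[OF p_M] by blast

lemma rot_differentiable:
  assumes s: "s \<in> qc_idx" and t: "t \<in> qc_idx"
  shows "(\<lambda>y. rot (chart_inv (chart_at A p) y) s t) differentiable (at (snd (chart_at A p) p))"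
proof -
  let ?c = "chart_at A p"
  have c: "?c \<in> A" "p \<in> fst ?c" by (rule F.chart_at_mem[OF p_M])+
  show ?thesis
  proof (rule differentiable_cong_open[OF open_overlap overlap])
    show "(\<lambda>y. F'.eta_c ?c s y (F.xi_c ?c t y)) differentiable (at (snd ?c p))"
    proof (rule differentiable_eval[OF open_overlap overlap])
      show "linear (F'.eta_c ?c s y)" if "y \<in> snd ?c ` ((U \<inter> U') \<inter> fst ?c)" for y
        by (rule F'.eta_c_linear[OF c(1) s]) (use that in blast)
      show "(\<lambda>y. F'.eta_c ?c s y v) differentiable (at (snd ?c p))" for v
        by (rule smooth_on_differentiable[OF F'.eta_c_smooth[OF c(1) s]]) (use p c in blast)
      show "F.xi_c ?c t differentiable (at (snd ?c p))"
        by (rule smooth_on_differentiable[OF F.xi_c_smooth[OF c(1) t]]) (use p c in blast)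
    qed
    fix y assume "y \<in> snd ?c ` ((U \<inter> U') \<inter> fst ?c)"
    then show "F'.eta_c ?c s y (F.xi_c ?c t y) = rot (chart_inv ?c y) s t"
      by (auto simp: rot_chart[OF c(1)] F.chart_inv_chart[OF c(1)])
  qed
qed

definition drot :: "nat \<Rightarrow> nat \<Rightarrow> 'e \<Rightarrow> real" where
  "drot s t u = frechet_derivative (\<lambda>y. rot (chart_inv (chart_at A p) y) s t)
     (at (snd (chart_at A p) p)) u"

text \<open>The Leibniz rule for \<open>eta'_eq\<close>, which holds throughout the overlap and may
  therefore be differentiated.\<close>

lemma ext_d_eta':
  assumes s: "s \<in> qc_idx"
  shows "ext_d A (\<eta>' s) p [u, v] =
    (drot s 1 u * \<eta> 1 p [v] - drot s 1 v * \<eta> 1 p [u] + rot p s 1 * ext_d A (\<eta> 1) p [u, v])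
    + (drot s 2 u * \<eta> 2 p [v] - drot s 2 v * \<eta> 2 p [u] + rot p s 2 * ext_d A (\<eta> 2) p [u, v])
    + (drot s 3 u * \<eta> 3 p [v] - drot s 3 v * \<eta> 3 p [u] + rot p s 3 * ext_d A (\<eta> 3) p [u, v])"
proof -
  let ?c = "chart_at A p"
  let ?r = "\<lambda>t y. rot (chart_inv ?c y) s t"
  have c: "?c \<in> A" "p \<in> fst ?c" by (rule F.chart_at_mem[OF p_M])+
  have diff: "(\<lambda>y. F.eta_c ?c t y v) differentiable (at (snd ?c p))" if "t \<in> qc_idx" for t v
    by (rule smooth_on_differentiable[OF F.eta_c_smooth[OF c(1) that]]) (use p c in blast)
  have eta_p: "F.eta_c ?c t (snd ?c p) v = \<eta> t p [v]" for t v
    by (simp add: F.eta_c_chart[OF c(1) p(1) c(2)] F.change_coord_self[OF c])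
  have r_p: "?r t (snd ?c p) = rot p s t" for t by (simp add: F.chart_inv_chart[OF c])
  have "frechet_derivative (\<lambda>y. F'.eta_c ?c s y v) (at (snd ?c p))
    = frechet_derivative (\<lambda>y. ?r 1 y * F.eta_c ?c 1 y v + ?r 2 y * F.eta_c ?c 2 y v
        + ?r 3 y * F.eta_c ?c 3 y v) (at (snd ?c p))" for v
    by (rule frechet_derivative_cong_open[OF open_overlap overlap])
      (auto simp: F'.eta_c_chart[OF c(1)] F.eta_c_chart[OF c(1)] F.chart_inv_chart[OF c(1)] eta'_eq[OF _ _ s])
  then have "frechet_derivative (\<lambda>y. F'.eta_c ?c s y v) (at (snd ?c p)) u
    = (drot s 1 u * \<eta> 1 p [v] + rot p s 1 * frechet_derivative (\<lambda>y. F.eta_c ?c 1 y v) (at (snd ?c p)) u)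
    + (drot s 2 u * \<eta> 2 p [v] + rot p s 2 * frechet_derivative (\<lambda>y. F.eta_c ?c 2 y v) (at (snd ?c p)) u)
    + (drot s 3 u * \<eta> 3 p [v] + rot p s 3 * frechet_derivative (\<lambda>y. F.eta_c ?c 3 y v) (at (snd ?c p)) u)"
    for u v
    unfolding drot_def
    using rot_differentiable[OF s]
    by (simp add: frechet_derivative_add_at frechet_derivative_mult_at diff eta_p r_p)
  then show ?thesis
    unfolding F.ext_d_pair F.eta_c_def F'.eta_c_def coord_d_def by (simp add: algebra_simps)
qed

lemma ext_d_eta'_H:
  assumes s: "s \<in> qc_idx" and "X \<in> H p" "Y \<in> H p"
  shows "ext_d A (\<eta>' s) p [X, Y] = rot p s 1 * ext_d A (\<eta> 1) p [X, Y]
    + rot p s 2 * ext_d A (\<eta> 2) p [X, Y] + rot p s 3 * ext_d A (\<eta> 3) p [X, Y]"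
  unfolding ext_d_eta'[OF s] using F.eta_H[OF p(1)] assms by simp

lemma g_diff: "X \<in> H p \<Longrightarrow> Y \<in> H p \<Longrightarrow> Z \<in> H p \<Longrightarrow> g p (X - Y) Z = g p X Z - g p Y Z"
  using F.g_lin[OF p_M, of X Y Z 1 "-1"] by simp

lemma g_comb3:
  assumes "X \<in> H p" "Y \<in> H p" "Z \<in> H p" "W \<in> H p"
  shows "g p (a *\<^sub>R X + b *\<^sub>R Y + c *\<^sub>R Z) W = a * g p X W + b * g p Y W + c * g p Z W"
proof -
  have "a *\<^sub>R X + b *\<^sub>R Y \<in> H p"
    using assms F.H_subspace[OF p_M] by (simp add: subspace_add subspace_scale)
  from F.g_lin[OF p_M this assms(3,4), of 1 c] show ?thesis
    using F.g_lin[OF p_M assms(1,2,4)] by simp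
qed

lemma H_comb3: "X \<in> H p \<Longrightarrow> Y \<in> H p \<Longrightarrow> Z \<in> H p \<Longrightarrow> a *\<^sub>R X + b *\<^sub>R Y + c *\<^sub>R Z \<in> H p"
  using F.H_subspace[OF p_M] by (simp add: subspace_add subspace_scale)

text \<open>On \<open>H\<close> the terms with derivatives of \<open>rot\<close> drop out, so both
  sides have the same inner product with every horizontal vector; their difference is horizontal and
  hence orthogonal to itself.\<close>

lemma I'_eq:
  assumes s: "s \<in> qc_idx" and X: "X \<in> H p"
  shows "I' s p X = rot p s 1 *\<^sub>R I 1 p X + rot p s 2 *\<^sub>R I 2 p X + rot p s 3 *\<^sub>R I 3 p X"
    (is "_ = ?Z")
proof -
  have I: "I t p X \<in> H p" if "t \<in> qc_idx" for t by (rule F.I_H[OF p(1) that X])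
  have I': "I' s p X \<in> H p" by (rule F'.I_H[OF p(2) s X])
  have Z: "?Z \<in> H p" using I by (intro H_comb3) auto
  have "g p (I' s p X) Y = g p ?Z Y" if Y: "Y \<in> H p" for Y
  proof -
    have "2 * g p (I' s p X) Y = rot p s 1 * (2 * g p (I 1 p X) Y) + rot p s 2 * (2 * g p (I 2 p X) Y)
        + rot p s 3 * (2 * g p (I 3 p X) Y)"
      using F'.g_I_ext_d[OF p(2) s X Y] ext_d_eta'_H[OF s X Y] F.g_I_ext_d[OF p(1) _ X Y] by simp
    then show ?thesis using g_comb3[OF I[of 1] I[of 2] I[of 3] Y] by simp
  qed
  moreover have diff: "I' s p X - ?Z \<in> H p"
    using F.H_subspace[OF p_M] I' Z by (rule subspace_diff)
  ultimately have "g p (I' s p X - ?Z) (I' s p X - ?Z) = 0"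
    using g_diff[OF I' Z diff] by simp
  then show ?thesis using F.g_eq_0[OF p_M diff] by simp
qed

lemma g_comb_I:
  assumes X: "X \<in> H p" and t: "t \<in> qc_idx"
  shows "g p (a 1 *\<^sub>R I 1 p X + a 2 *\<^sub>R I 2 p X + a 3 *\<^sub>R I 3 p X) (I t p X) = a t * g p X X"
proof -
  have I: "I t p X \<in> H p" if "t \<in> qc_idx" for t by (rule F.I_H[OF p(1) that X])
  show ?thesis
    using g_comb3[OF I[of 1] I[of 2] I[of 3] I[OF t]] F.g_I_I[OF p(1) _ t X] t by auto
qed

text \<open>The inner products of the vectors \<open>I' s p X\<close> are computed once from
  \<open>g_I_I\<close> for the second frame and once by expanding in the first; the positive number
  \<open>g p X X\<close> is then cancelled.\<close>

lemma rot_rows: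
  assumes s: "s \<in> qc_idx" and k: "k \<in> qc_idx"
  shows "rot p s 1 * rot p k 1 + rot p s 2 * rot p k 2 + rot p s 3 * rot p k 3
    = (if s = k then 1 else 0)"
proof -
  obtain X where X: "X \<in> H p" "X \<noteq> 0" using F.H_nonzero[OF p_M] .
  have I: "I t p X \<in> H p" if "t \<in> qc_idx" for t by (rule F.I_H[OF p(1) that X(1)])
  have I': "I' k p X \<in> H p" by (rule F'.I_H[OF p(2) k X(1)])
  have *: "g p (I t p X) (I' k p X) = rot p k t * g p X X" if t: "t \<in> qc_idx" for t
    using g_comb_I[OF X(1) t, of "rot p k"] I'_eq[OF k X(1)] F.g_sym[OF p_M I[OF t] I'] by simp
  have "g p (I' s p X) (I' k p X) = rot p s 1 * (rot p k 1 * g p X X)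
      + rot p s 2 * (rot p k 2 * g p X X) + rot p s 3 * (rot p k 3 * g p X X)"
    using g_comb3[OF I[of 1] I[of 2] I[of 3] I'] I'_eq[OF s X(1)] by (simp add: *)
  then have "(rot p s 1 * rot p k 1 + rot p s 2 * rot p k 2 + rot p s 3 * rot p k 3) * g p X X
      = (if s = k then 1 else 0) * g p X X"
    using F'.g_I_I[OF p(2) s k X(1)] by (cases "s = k") (simp_all add: algebra_simps)
  then show ?thesis using F.g_pos[OF p_M X] by simp
qed

text \<open>The product of two imaginary quaternions is their cross product minus their scalar
  product. Applied to \<open>I' 1\<close> after \<open>I' 2\<close>, whose rows are orthogonal, it
  gives the third row and so fixes the orientation.\<close>

lemma rot_third:
  shows "rot p 3 1 = rot p 1 2 * rot p 2 3 - rot p 1 3 * rot p 2 2"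
    and "rot p 3 2 = rot p 1 3 * rot p 2 1 - rot p 1 1 * rot p 2 3"
    and "rot p 3 3 = rot p 1 1 * rot p 2 2 - rot p 1 2 * rot p 2 1"
proof -
  obtain X where X: "X \<in> H p" "X \<noteq> 0" using F.H_nonzero[OF p_M] .
  have I: "I t p X \<in> H p" if "t \<in> qc_idx" for t by (rule F.I_H[OF p(1) that X(1)])
  \<comment> \<open>Another horizontal vector, at which \<open>I'_eq\<close> is applied a second
    time.\<close>
  define Y where "Y = I' 2 p X"
  have Y: "Y \<in> H p" unfolding Y_def by (rule F'.I_H[OF p(2) _ X(1)]) simp
  have Y_eq: "Y = rot p 2 1 *\<^sub>R I 1 p X + rot p 2 2 *\<^sub>R I 2 p X + rot p 2 3 *\<^sub>R I 3 p X"
    unfolding Y_def by (rule I'_eq[OF _ X(1)]) simp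
  have IY: "I t p Y = rot p 2 1 *\<^sub>R I t p (I 1 p X) + rot p 2 2 *\<^sub>R I t p (I 2 p X)
      + rot p 2 3 *\<^sub>R I t p (I 3 p X)" if t: "t \<in> qc_idx" for t
  proof -
    have "rot p 2 1 *\<^sub>R I 1 p X + rot p 2 2 *\<^sub>R I 2 p X \<in> H p"
      using I F.H_subspace[OF p_M] by (simp add: subspace_add subspace_scale)
    from F.I_lin[OF p(1) t this I[of 3], of 1 "rot p 2 3"] show ?thesis
      unfolding Y_eq using F.I_lin[OF p(1) t I[of 1] I[of 2]] by simp
  qed
  have "rot p 3 1 *\<^sub>R I 1 p X + rot p 3 2 *\<^sub>R I 2 p X + rot p 3 3 *\<^sub>R I 3 p X = I' 1 p Y"
    using I'_eq[OF _ X(1), of 3] F'.I_table(2)[OF p(2) X(1)] unfolding Y_def by simp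
  also have "\<dots> = rot p 1 1 *\<^sub>R I 1 p Y + rot p 1 2 *\<^sub>R I 2 p Y + rot p 1 3 *\<^sub>R I 3 p Y"
    by (rule I'_eq[OF _ Y]) simp
  also have "\<dots> = (rot p 1 2 * rot p 2 3 - rot p 1 3 * rot p 2 2) *\<^sub>R I 1 p X
      + (rot p 1 3 * rot p 2 1 - rot p 1 1 * rot p 2 3) *\<^sub>R I 2 p X
      + (rot p 1 1 * rot p 2 2 - rot p 1 2 * rot p 2 1) *\<^sub>R I 3 p X
      - (rot p 1 1 * rot p 2 1 + rot p 1 2 * rot p 2 2 + rot p 1 3 * rot p 2 3) *\<^sub>R X"
    using F.I_table[OF p(1) X(1)] by (simp add: IY algebra_simps)
  also have "\<dots> = (rot p 1 2 * rot p 2 3 - rot p 1 3 * rot p 2 2) *\<^sub>R I 1 p X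
      + (rot p 1 3 * rot p 2 1 - rot p 1 1 * rot p 2 3) *\<^sub>R I 2 p X
      + (rot p 1 1 * rot p 2 2 - rot p 1 2 * rot p 2 1) *\<^sub>R I 3 p X"
    using rot_rows[of 1 2] by simp
  finally have eq: "rot p 3 1 *\<^sub>R I 1 p X + rot p 3 2 *\<^sub>R I 2 p X + rot p 3 3 *\<^sub>R I 3 p X = \<dots>" .
  \<comment> \<open>The cross product as a function of the index, so that \<open>g_comb_I\<close>
    can read off the coefficients on both sides.\<close>
  define a where "a t = (if t = 1 then rot p 1 2 * rot p 2 3 - rot p 1 3 * rot p 2 2
    else if t = 2 then rot p 1 3 * rot p 2 1 - rot p 1 1 * rot p 2 3
    else rot p 1 1 * rot p 2 2 - rot p 1 2 * rot p 2 1)" for t :: nat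
  have "rot p 3 t * g p X X = a t * g p X X" if t: "t \<in> qc_idx" for t
  proof -
    have "rot p 3 1 *\<^sub>R I 1 p X + rot p 3 2 *\<^sub>R I 2 p X + rot p 3 3 *\<^sub>R I 3 p X
        = a 1 *\<^sub>R I 1 p X + a 2 *\<^sub>R I 2 p X + a 3 *\<^sub>R I 3 p X"
      using eq by (simp add: a_def)
    then show ?thesis
      using g_comb_I[OF X(1) t, of "rot p 3"] g_comb_I[OF X(1) t, of a] by simp
  qed
  then have "rot p 3 t = a t" if "t \<in> qc_idx" for t using F.g_pos[OF p_M X] that by auto
  from this[of 1] this[of 2] this[of 3] show
    "rot p 3 1 = rot p 1 2 * rot p 2 3 - rot p 1 3 * rot p 2 2"
    "rot p 3 2 = rot p 1 3 * rot p 2 1 - rot p 1 1 * rot p 2 3"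
    "rot p 3 3 = rot p 1 1 * rot p 2 2 - rot p 1 2 * rot p 2 1"
    by (simp_all add: a_def)
qed

end

lemma rot_columns:
  assumes "p \<in> U" "p \<in> U'" and "t \<in> qc_idx" "u \<in> qc_idx"
  shows "rot p 1 t * rot p 1 u + rot p 2 t * rot p 2 u + rot p 3 t * rot p 3 u = (if t = u then 1 else 0)"
  using rot_rows[OF assms(1,2)] assms(3,4) by (rule orthonormal_columns3)

text \<open>The rows have unit length on the whole overlap, not only at \<open>p\<close>, so this
  identity may be differentiated.\<close>

lemma drot_rows:
  assumes p: "p \<in> U" "p \<in> U'" and s: "s \<in> qc_idx"
  shows "rot p s 1 * drot p s 1 u + rot p s 2 * drot p s 2 u + rot p s 3 * drot p s 3 u = 0"
proof -
  let ?c = "chart_at A p"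
  let ?r = "\<lambda>t y. rot (chart_inv ?c y) s t"
  have c: "?c \<in> A" "p \<in> fst ?c" by (rule F.chart_at_mem[OF p_M[OF p]])+
  have r_p: "?r t (snd ?c p) = rot p s t" for t by (simp add: F.chart_inv_chart[OF c])
  have "frechet_derivative (\<lambda>y. ?r 1 y * ?r 1 y + ?r 2 y * ?r 2 y + ?r 3 y * ?r 3 y) (at (snd ?c p))
    = frechet_derivative (\<lambda>y. 1) (at (snd ?c p))"
    by (rule frechet_derivative_cong_open[OF open_overlap[OF p] overlap[OF p]])
      (auto simp: F.chart_inv_chart[OF c(1)] rot_rows[OF _ _ s s, simplified])
  then have "2 * (rot p s 1 * drot p s 1 u + rot p s 2 * drot p s 2 u + rot p s 3 * drot p s 3 u) = 0"
    unfolding drot_def[OF p]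
    using rot_differentiable[OF p s]
    by (simp add: frechet_derivative_add_at frechet_derivative_mult_at r_p fun_eq_iff)
  then show ?thesis by simp
qed

text \<open>Both sides have the same values under the second triple of contact forms, so their
  difference \<open>h\<close> is horizontal. Both also satisfy the Reeb condition for
  \<open>\<eta>' s\<close>, and nondegeneracy on \<open>H\<close> forces
  \<open>h = 0\<close>.\<close>

lemma xi'_eq:
  assumes p: "p \<in> U" "p \<in> U'" and s: "s \<in> qc_idx"
  shows "\<xi>' s p = rot p s 1 *\<^sub>R \<xi> 1 p + rot p s 2 *\<^sub>R \<xi> 2 p + rot p s 3 *\<^sub>R \<xi> 3 p"
proof -
  define Z where "Z = rot p s 1 *\<^sub>R \<xi> 1 p + rot p s 2 *\<^sub>R \<xi> 2 p + rot p s 3 *\<^sub>R \<xi> 3 p"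
  define h where "h = \<xi>' s p - Z"
  have eta_comb: "linear (\<lambda>v. f v) \<Longrightarrow>
      f Z = rot p s 1 * f (\<xi> 1 p) + rot p s 2 * f (\<xi> 2 p) + rot p s 3 * f (\<xi> 3 p)"
    for f :: "'e \<Rightarrow> real"
    unfolding Z_def by (simp add: linear_add linear_cmul)
  have "\<eta>' k p [h] = 0" if k: "k \<in> qc_idx" for k
  proof -
    note lin = F'.eta_linear[OF k p(2)]
    have "\<eta>' k p [Z] = rot p s 1 * rot p k 1 + rot p s 2 * rot p k 2 + rot p s 3 * rot p k 3"
      using eta_comb[OF lin] by (simp add: rot_def)
    then show ?thesis
      using rot_rows[OF p s k] F'.eta_xi[OF p(2) k s] by (auto simp: h_def linear_diff[OF lin])
  qed
  then have h: "h \<in> H p" using F'.H_iff[OF p(2)] by blast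
  \<comment> \<open>The double sum of \<open>rot p s t * rot p s u\<close> times the derivative of
    \<open>\<eta> t\<close> at \<open>\<xi> u\<close> and \<open>X\<close> vanishes, being
    antisymmetric in \<open>t\<close>, \<open>u\<close> by the Reeb conditions. What remains is the
    derivative along \<open>X\<close> of half the squared row length, up to sign.\<close>
  have "ext_d A (\<eta>' s) p [Z, X] = 0" if X: "X \<in> H p" for X
  proof -
    have eta_Z: "\<eta> t p [Z] = rot p s t" if t: "t \<in> qc_idx" for t
      using eta_comb[OF F.eta_linear[OF t p(1)]] F.eta_xi[OF p(1) t] t by auto
    have Z: "\<eta> 1 p [Z] = rot p s 1" "\<eta> 2 p [Z] = rot p s 2" "\<eta> 3 p [Z] = rot p s 3"
      by (rule eta_Z; simp)+
    have X0: "\<eta> 1 p [X] = 0" "\<eta> 2 p [X] = 0" "\<eta> 3 p [X] = 0"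
      by (rule F.eta_H[OF p(1) X]; simp)+
    have ext_d_Z: "ext_d A (\<eta> t) p [Z, X] = rot p s 1 * ext_d A (\<eta> t) p [\<xi> 1 p, X]
        + rot p s 2 * ext_d A (\<eta> t) p [\<xi> 2 p, X] + rot p s 3 * ext_d A (\<eta> t) p [\<xi> 3 p, X]"
      if t: "t \<in> qc_idx" for t
      using F.bilinear_ext_d_eta[OF t p(1)] by (intro eta_comb) (simp add: bilinear_def)
    have B: "ext_d A (\<eta> 1) p [Z, X] = rot p s 1 * ext_d A (\<eta> 1) p [\<xi> 1 p, X]
        + rot p s 2 * ext_d A (\<eta> 1) p [\<xi> 2 p, X] + rot p s 3 * ext_d A (\<eta> 1) p [\<xi> 3 p, X]"
      "ext_d A (\<eta> 2) p [Z, X] = rot p s 1 * ext_d A (\<eta> 2) p [\<xi> 1 p, X]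
        + rot p s 2 * ext_d A (\<eta> 2) p [\<xi> 2 p, X] + rot p s 3 * ext_d A (\<eta> 2) p [\<xi> 3 p, X]"
      "ext_d A (\<eta> 3) p [Z, X] = rot p s 1 * ext_d A (\<eta> 3) p [\<xi> 1 p, X]
        + rot p s 2 * ext_d A (\<eta> 3) p [\<xi> 2 p, X] + rot p s 3 * ext_d A (\<eta> 3) p [\<xi> 3 p, X]"
      by (rule ext_d_Z; simp)+
    have swap: "ext_d A (\<eta> 2) p [\<xi> 1 p, X] = - ext_d A (\<eta> 1) p [\<xi> 2 p, X]"
      "ext_d A (\<eta> 3) p [\<xi> 1 p, X] = - ext_d A (\<eta> 1) p [\<xi> 3 p, X]"
      "ext_d A (\<eta> 3) p [\<xi> 2 p, X] = - ext_d A (\<eta> 2) p [\<xi> 3 p, X]"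
      by (rule F.reeb_swap[OF p(1) _ _ X]; simp)+
    have self: "ext_d A (\<eta> 1) p [\<xi> 1 p, X] = 0" "ext_d A (\<eta> 2) p [\<xi> 2 p, X] = 0"
      "ext_d A (\<eta> 3) p [\<xi> 3 p, X] = 0"
      by (rule F.reeb_self[OF p(1) _ X]; simp)+
    have "ext_d A (\<eta>' s) p [Z, X]
      = - (rot p s 1 * drot p s 1 X + rot p s 2 * drot p s 2 X + rot p s 3 * drot p s 3 X)"
      unfolding ext_d_eta'[OF p s] Z X0 B swap self by (simp add: algebra_simps)
    then show ?thesis unfolding drot_rows[OF p s] by simp
  qed
  moreover have "ext_d A (\<eta>' s) p [\<xi>' s p, X] = 0" if "X \<in> H p" for X
    by (rule F'.reeb_self[OF p(2) s that])
  moreover have "linear (\<lambda>u. ext_d A (\<eta>' s) p [u, X])" for X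
    using F'.bilinear_ext_d_eta[OF s p(2)] by (simp add: bilinear_def)
  ultimately have "ext_d A (\<eta>' s) p [h, X] = 0" if "X \<in> H p" for X
    unfolding h_def using that linear_diff[of "\<lambda>u. ext_d A (\<eta>' s) p [u, X]"] by simp
  \<comment> \<open>The test vector is \<open>I' s p h\<close>, for which the metric relation gives
    the squared length of \<open>I' s p h\<close>.\<close>
  then have "g p (I' s p h) (I' s p h) = 0"
    using F'.g_I_ext_d[OF p(2) s h F'.I_H[OF p(2) s h]] F'.I_H[OF p(2) s h] by simp
  then have "g p h h = 0" using F'.g_I[OF p(2) s h h] by simp
  then show ?thesis using F.g_eq_0[OF p_M[OF p] h] by (simp add: h_def Z_def)
qed

text \<open>Contact forms and Reeb fields transform by the same orthogonal matrix, so the vertical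
  parts of \<open>v\<close> agree.\<close>

lemma horizontal'_eq:
  assumes p: "p \<in> U" "p \<in> U'"
  shows "horizontal \<eta>' \<xi>' p v = horizontal \<eta> \<xi> p v"
proof -
  have xi: "\<xi>' 1 p = rot p 1 1 *\<^sub>R \<xi> 1 p + rot p 1 2 *\<^sub>R \<xi> 2 p + rot p 1 3 *\<^sub>R \<xi> 3 p"
    "\<xi>' 2 p = rot p 2 1 *\<^sub>R \<xi> 1 p + rot p 2 2 *\<^sub>R \<xi> 2 p + rot p 2 3 *\<^sub>R \<xi> 3 p"
    "\<xi>' 3 p = rot p 3 1 *\<^sub>R \<xi> 1 p + rot p 3 2 *\<^sub>R \<xi> 2 p + rot p 3 3 *\<^sub>R \<xi> 3 p"
    by (rule xi'_eq[OF p]; simp)+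
  have eta: "\<eta>' 1 p [v] = rot p 1 1 * \<eta> 1 p [v] + rot p 1 2 * \<eta> 2 p [v] + rot p 1 3 * \<eta> 3 p [v]"
    "\<eta>' 2 p [v] = rot p 2 1 * \<eta> 1 p [v] + rot p 2 2 * \<eta> 2 p [v] + rot p 2 3 * \<eta> 3 p [v]"
    "\<eta>' 3 p [v] = rot p 3 1 * \<eta> 1 p [v] + rot p 3 2 * \<eta> 2 p [v] + rot p 3 3 * \<eta> 3 p [v]"
    by (rule eta'_eq[OF p]; simp)+
  \<comment> \<open>The Gram matrix of the columns, kept folded until \<open>rot_columns\<close>
    identifies it with the identity.\<close>
  define cc where "cc t u = rot p 1 t * rot p 1 u + rot p 2 t * rot p 2 u + rot p 3 t * rot p 3 u" for t u
  have "\<eta>' 1 p [v] *\<^sub>R \<xi>' 1 p + \<eta>' 2 p [v] *\<^sub>R \<xi>' 2 p + \<eta>' 3 p [v] *\<^sub>R \<xi>' 3 p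
    = (cc 1 1 * \<eta> 1 p [v] + cc 2 1 * \<eta> 2 p [v] + cc 3 1 * \<eta> 3 p [v]) *\<^sub>R \<xi> 1 p
      + (cc 1 2 * \<eta> 1 p [v] + cc 2 2 * \<eta> 2 p [v] + cc 3 2 * \<eta> 3 p [v]) *\<^sub>R \<xi> 2 p
      + (cc 1 3 * \<eta> 1 p [v] + cc 2 3 * \<eta> 2 p [v] + cc 3 3 * \<eta> 3 p [v]) *\<^sub>R \<xi> 3 p"
    unfolding xi eta cc_def by (simp add: algebra_simps)
  moreover have "cc t u = (if t = u then 1 else 0)" if "t \<in> qc_idx" "u \<in> qc_idx" for t u
    unfolding cc_def by (rule rot_columns[OF p that])
  ultimately show ?thesis
    unfolding F.horizontal_sum F'.horizontal_sum by simp
qed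

lemma omega'_eq:
  assumes p: "p \<in> U" "p \<in> U'" and s: "s \<in> qc_idx" and "length l = 2"
  shows "qc_omega A \<eta>' \<xi>' s p l = rot p s 1 * qc_omega A \<eta> \<xi> 1 p l
    + rot p s 2 * qc_omega A \<eta> \<xi> 2 p l + rot p s 3 * qc_omega A \<eta> \<xi> 3 p l"
proof -
  obtain u v where l: "l = [u, v]" using length_2_conv[OF assms(4)] by blast
  show ?thesis
    unfolding l F.omega_pair F'.omega_pair horizontal'_eq[OF p]
    by (simp add: ext_d_eta'_H[OF p s F.horizontal_H[OF p(1)] F.horizontal_H[OF p(1)]] field_simps)
qed

lemma local_Omega'_eq:
  assumes p: "p \<in> U" "p \<in> U'"
  shows "local_Omega A \<eta>' \<xi>' p = local_Omega A \<eta> \<xi> p"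
proof
  fix vs
  show "local_Omega A \<eta>' \<xi>' p vs = local_Omega A \<eta> \<xi> p vs"
    unfolding local_Omega_def Let_def
    by (rule wedge_sum_rotation[where a = "rot p" and p = p and \<alpha> = "qc_omega A \<eta> \<xi>" and \<alpha>' = "qc_omega A \<eta>' \<xi>'"
          and \<beta> = "qc_omega A \<eta> \<xi>" and \<beta>' = "qc_omega A \<eta>' \<xi>'",
        OF rot_columns[OF p] omega'_eq[OF p] omega'_eq[OF p]])
qed

text \<open>Products of two contact forms transform by cofactors, which for a rotation are the
  entries of \<open>rot p\<close> itself. They thus transform like the \<open>\<omega>\<close>, and
  \<open>wedge_sum_rotation\<close> applies to the mixed terms.\<close>

lemma local_Omega_Q'_eq:
  assumes p: "p \<in> U" "p \<in> U'"
  shows "local_Omega_Q A \<eta>' \<xi>' p = local_Omega_Q A \<eta> \<xi> p"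
proof
  fix vs
  \<comment> \<open>The cyclic successor, which gives the three products of contact forms one common
    formula.\<close>
  define next_idx :: "nat \<Rightarrow> nat" where "next_idx s = (if s = 3 then 1 else Suc s)" for s
  define V where "V s = wedge 1 1 (\<eta> (next_idx s)) (\<eta> (next_idx (next_idx s)))" for s
  define V' where "V' s = wedge 1 1 (\<eta>' (next_idx s)) (\<eta>' (next_idx (next_idx s)))" for s
  have V: "V 1 = wedge 1 1 (\<eta> 2) (\<eta> 3)" "V 2 = wedge 1 1 (\<eta> 3) (\<eta> 1)" "V 3 = wedge 1 1 (\<eta> 1) (\<eta> 2)"
    and V': "V' 1 = wedge 1 1 (\<eta>' 2) (\<eta>' 3)" "V' 2 = wedge 1 1 (\<eta>' 3) (\<eta>' 1)" "V' 3 = wedge 1 1 (\<eta>' 1) (\<eta>' 2)"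
    by (simp_all add: V_def V'_def next_idx_def numeral_2_eq_2 numeral_3_eq_3)
  have cof: "rot p s 1 = rot p (next_idx s) 2 * rot p (next_idx (next_idx s)) 3
        - rot p (next_idx s) 3 * rot p (next_idx (next_idx s)) 2"
      "rot p s 2 = rot p (next_idx s) 3 * rot p (next_idx (next_idx s)) 1
        - rot p (next_idx s) 1 * rot p (next_idx (next_idx s)) 3"
      "rot p s 3 = rot p (next_idx s) 1 * rot p (next_idx (next_idx s)) 2
        - rot p (next_idx s) 2 * rot p (next_idx (next_idx s)) 1"
    if "s \<in> qc_idx" for s
    using that rot_third[OF p] rotation_cofactors[OF rot_rows[OF p] rot_third[OF p]]
    by (auto simp: next_idx_def numeral_2_eq_2 numeral_3_eq_3)
  have next_mem: "next_idx s \<in> qc_idx" if "s \<in> qc_idx" for s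
    using that by (auto simp: next_idx_def)
  have "V' s p l = rot p s 1 * V 1 p l + rot p s 2 * V 2 p l + rot p s 3 * V 3 p l"
    if s: "s \<in> qc_idx" and l: "length l = 2" for s l
  proof -
    obtain u v where l: "l = [u, v]" using length_2_conv[OF l] by blast
    note e = eta'_eq[OF p next_mem[OF s]] eta'_eq[OF p next_mem[OF next_mem[OF s]]]
    show ?thesis
      unfolding V V'_def l wedge_1_1 wedge11_def e cof[OF s] by (simp add: algebra_simps)
  qed
  from wedge_sum_rotation[where a = "rot p" and p = p and \<alpha> = "qc_omega A \<eta> \<xi>" and \<alpha>' = "qc_omega A \<eta>' \<xi>'"
          and \<beta> = "V" and \<beta>' = "V'",
        OF rot_columns[OF p] omega'_eq[OF p] this]
  have "wedge 2 2 (qc_omega A \<eta>' \<xi>' 1) (V' 1) p vs + wedge 2 2 (qc_omega A \<eta>' \<xi>' 2) (V' 2) p vs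
      + wedge 2 2 (qc_omega A \<eta>' \<xi>' 3) (V' 3) p vs
    = wedge 2 2 (qc_omega A \<eta> \<xi> 1) (V 1) p vs + wedge 2 2 (qc_omega A \<eta> \<xi> 2) (V 2) p vs
      + wedge 2 2 (qc_omega A \<eta> \<xi> 3) (V 3) p vs" by simp
  moreover have "local_Omega A \<eta>' \<xi>' p vs = local_Omega A \<eta> \<xi> p vs"
    using local_Omega'_eq[OF p] by simp
  ultimately show "local_Omega_Q A \<eta>' \<xi>' p vs = local_Omega_Q A \<eta> \<xi> p vs"
    unfolding local_Omega_Q_def local_Omega_def Let_def V V' by linarith
qed

end

section \<open>From local expressions to the global forms\<close>

text \<open>The frame selected at \<open>q\<close> is some valid frame around \<open>q\<close>,
  because the given one witnesses existence. It may vary arbitrarily with \<open>q\<close>, so the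
  comparison is made pointwise.\<close>

lemma (in qc_local) chosen_frame_forms:
  assumes q: "q \<in> U"
  shows "fundamental_four_form A H g Q q = local_Omega A \<eta> \<xi> q"
    and "Omega_Q A H g Q q = local_Omega_Q A \<eta> \<xi> q"
proof -
  obtain \<eta>' \<xi>' where ch: "chosen_frame A H g Q q = (\<eta>', \<xi>')" by fastforce
  have "\<exists>f. case f of (\<eta>, \<xi>) \<Rightarrow> \<exists>U I. q \<in> U \<and> qc_frame A H g Q U \<eta> I \<xi>"
    using q frame by auto
  from someI_ex[OF this] obtain U' I' where U': "q \<in> U'" "qc_frame A H g Q U' \<eta>' I' \<xi>'"
    unfolding chosen_frame_def[symmetric] ch by auto
  interpret two: qc_two_frames M A n H g Q U \<eta> I \<xi> U' \<eta>' I' \<xi>'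
    by unfold_locales (rule U'(2))
  show "fundamental_four_form A H g Q q = local_Omega A \<eta> \<xi> q"
    "Omega_Q A H g Q q = local_Omega_Q A \<eta> \<xi> q"
    unfolding fundamental_four_form_def Omega_Q_def ch
    using two.local_Omega'_eq[OF q U'(1)] two.local_Omega_Q'_eq[OF q U'(1)] by simp_all
qed

text \<open>\<open>ext_d\<close> at \<open>p\<close> depends only on the values of the form near
  \<open>p\<close>.\<close>

lemma (in atlas_manifold) ext_d_cong_open:
  assumes "open U" "U \<subseteq> M" and p: "p \<in> U" and eq: "\<And>q. q \<in> U \<Longrightarrow> \<alpha> q = \<beta> q"
  shows "ext_d A \<alpha> p vs = ext_d A \<beta> p vs"
proof -
  let ?c = "chart_at A p"
  have c: "?c \<in> A" "p \<in> fst ?c" using chart_at_mem p assms(2) by blast+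
  have "frechet_derivative (\<lambda>y. chart_rep A ?c \<alpha> y ws) (at (snd ?c p))
    = frechet_derivative (\<lambda>y. chart_rep A ?c \<beta> y ws) (at (snd ?c p))" for ws
    by (rule frechet_derivative_cong_open[OF open_chart_image[OF c(1) assms(1)]])
      (use p c in \<open>auto simp: chart_rep_chart[OF c(1)] eq\<close>)
  then show ?thesis unfolding ext_d_def Let_def by simp
qed

theorem proposition4p5:
  fixes n :: nat
    and M :: "'a::{t2_space,second_countable_topology} set"
    and A :: "('a, 'e::euclidean_space) chart set"
    and H :: "'a \<Rightarrow> 'e set"
    and g :: "'a \<Rightarrow> 'e \<Rightarrow> 'e \<Rightarrow> real"
    and Q :: "'a \<Rightarrow> ('e \<Rightarrow> 'e) set"
  assumes "n \<ge> 1" and "qc_manifold n M A H g Q"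
  shows "sp_hypo M A H g Q \<longleftrightarrow> closed_form A M 4 (fundamental_four_form A H g Q)"
proof -
  have "smooth_atlas M A" using assms(2) unfolding qc_manifold_def by blast
  then interpret qc_geometry M A n H g Q
    using assms by unfold_locales
  have "ext_d A (Omega_Q A H g Q) p vs = ext_d A (fundamental_four_form A H g Q) p vs"
    if p: "p \<in> M" and vs: "length vs = Suc 4" for p vs
  proof -
    obtain U \<eta> I \<xi> where "p \<in> U" and frame: "qc_frame A H g Q U \<eta> I \<xi>"
      using assms(2) p unfolding qc_manifold_def by blast
    interpret qc_local M A n H g Q U \<eta> I \<xi> by unfold_locales (rule frame)
    \<comment> \<open>One frame serves all of \<open>U\<close>: the global forms agree with its
      local expressions on a neighbourhood of \<open>p\<close>, as taking derivatives
      requires.\<close>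
    note cong = ext_d_cong_open[OF U_open U_subset \<open>p \<in> U\<close>]
    have "ext_d A (Omega_Q A H g Q) p vs = ext_d A (local_Omega_Q A \<eta> \<xi>) p vs"
      by (rule cong) (rule chosen_frame_forms(2))
    also have "\<dots> = ext_d A (local_Omega A \<eta> \<xi>) p vs"
      using \<open>p \<in> U\<close> vs by (intro ext_d_local_Omega_Q) simp_all
    also have "\<dots> = ext_d A (fundamental_four_form A H g Q) p vs"
      by (rule cong) (rule chosen_frame_forms(1)[symmetric])
    finally show ?thesis .
  qed
  then show ?thesis unfolding sp_hypo_def closed_form_def by simp
qed

end
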